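(* Let $\mathcal{A},\mathcal{A}'$ be two regular categories and let $\delta,\delta'$ be degree functions on $\mathcal{A},\mathcal{A}'$ respectively. Let $F:\mathcal{A}\rightleftarrows\mathcal{A}':G$ be a pair of adjoint functors, with $G$ left adjoint to $F$, both preserving the degree functions, and such that $G$ preserves pullbacks. Let $\varepsilon:GF\Rightarrow\mathrm{Id}_{\mathcal{A}}$ and $\eta:\mathrm{Id}_{\mathcal{A}'}\Rightarrow FG$ be the counit and unit of the adjunction. Assume that for any two arrows $f:x\to y$ in $\mathcal{A}$ and $f':x'\to y'$ in $\mathcal{A}'$ the following two commutative squares are Cartesian: the square with top arrow $\eta_{x'}:x'\to FG(x')$, bottom arrow $\eta_{y'}:y'\to FG(y')$, left vertical arrow $f'$ and right vertical arrow $FG(f')$; and the square with top arrow $\varepsilon_x:GF(x)\to x$, bottom arrow $\varepsilon_y:GF(y)\to y$, left vertical arrow $GF(f)$ and right vertical arrow $f$. Then the induced $\mathbb{K}$-linear symmetric monoidal functor $\overline{F}:\mathcal{T}(\mathcal{A},\delta)\to\mathcal{T}(\mathcal{A}',\delta')$ preserves limits (those which exist in $\mathcal{T}(\mathcal{A},\delta)$).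
   Context: $\mathbb{K}$ is a fixed field; all categories considered are well-powered. Following Knop, a category $\mathcal{A}$ is called regular if: it has a terminal object $\mathbf{1}_{\mathcal{A}}$; all morphisms have images (epi-mono factorizations, unique up to isomorphism); the pullback $x\times_z y$ exists whenever $x\to z\leftarrow y$ can be completed to a commutative square by some $w\to x$, $w\to y$; for any epimorphism $x\twoheadrightarrow z$ and any $y\to z$ the pullback $x\times_z y$ exists; epimorphisms are preserved under pullbacks. A degree function on $\mathcal{A}$ is a map $\delta:Epi(\mathcal{A})\to\mathbb{K}$ on the epimorphisms of $\mathcal{A}$ with $\delta(\mathrm{Id}_x)=1$, $\delta(e'e)=\delta(e')\delta(e)$ for composable epimorphisms, and $\delta(e')=\delta(e)$ whenever $e'$ is a pullback of $e$. A relation between $x$ and $y$ is a subobject $r\subset x\times y$. For relations $r\subset x\times y$, $s\subset y\times z$, their product is $r\star s:=\mathrm{im}(r\times_y s\to x\times z)$. The $\mathbb{K}$-linear category $\mathcal{T}^0(\mathcal{A},\delta)$ has objects $[x]$ for $x\in\mathcal{A}$; morphisms $[x]\to[y]$ are formal $\mathbb{K}$-linear combinations of symbols $\langle r\rangle$, $r\subset x\times y$ a relation; composition is $\langle s\rangle\circ\langle r\rangle:=\delta(e)\langle r\star s\rangle$ if $r\times_y s$ exists, where $e:r\times_y s\twoheadrightarrow r\star s$, and $0$ otherwise. $\mathcal{T}(\mathcal{A},\delta)$ is the additive Karoubi completion of $\mathcal{T}^0(\mathcal{A},\delta)$, with symmetric monoidal structure $[x]\otimes[y]:=[x\times y]$.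 A functor $F:\mathcal{A}\to\mathcal{A}'$ preserves the degree functions $\delta,\delta'$ if $F$ preserves epimorphisms and $\delta'(F(e))=\delta(e)$ for every epimorphism $e$ in $\mathcal{A}$ (and similarly for $G:\mathcal{A}'\to\mathcal{A}$, with $\delta(G(e'))=\delta'(e')$). For a functor $F:\mathcal{A}\to\mathcal{A}'$ preserving degree functions and pullbacks (here $F$, being a right adjoint, preserves pullbacks and terminal objects), the induced functor $\overline{F}:\mathcal{T}(\mathcal{A},\delta)\to\mathcal{T}(\mathcal{A}',\delta')$ is the $\mathbb{K}$-linear extension to Karoubi completions of $[x]\mapsto[F(x)]$, $\langle r\rangle\mapsto\langle F(r)\rangle$, where for $r\subset x\times y$ one views $F(r)\subset F(x\times y)$ as a subobject of $F(x)\times F(y)$ via the natural monomorphism $F(x\times y)\to F(x)\times F(y)$.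
   Formalization: "G preserves pullbacks" is taken to include that G(x)×_{G(z)}G(y) exists only if x×_z y exists; without this the claim fails, e.g. for nonempty countable sets and sets surjecting onto an infinite X, with F = X×− and G forgetful. *)

theory Defs
  imports "HOL-Library.Poly_Mapping"
begin

section \<open>Categories, functors, limits\<close>

text \<open>
  The arrows of a category form a set, so every object has a set of subobjects and
  well-poweredness is automatic. \<open>Comp C g f\<close> is \<open>g \<circ> f\<close>.
\<close>

record ('o, 'a) cat =
  Obj :: "'o set"
  Arr :: "'a set"
  Dom :: "'a \<Rightarrow> 'o"
  Cod :: "'a \<Rightarrow> 'o"
  Idt :: "'o \<Rightarrow> 'a"
  Comp :: "'a \<Rightarrow> 'a \<Rightarrow> 'a"

definition hom :: "('o, 'a) cat \<Rightarrow> 'o \<Rightarrow> 'o \<Rightarrow> 'a set" where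
  "hom C x y = {f \<in> Arr C. Dom C f = x \<and> Cod C f = y}"

locale category =
  fixes C :: "('o, 'a) cat"
  assumes dom_obj: "f \<in> Arr C \<Longrightarrow> Dom C f \<in> Obj C"
    and cod_obj: "f \<in> Arr C \<Longrightarrow> Cod C f \<in> Obj C"
    and idt_hom: "x \<in> Obj C \<Longrightarrow> Idt C x \<in> hom C x x"
    and comp_hom: "f \<in> hom C x y \<Longrightarrow> g \<in> hom C y z \<Longrightarrow> Comp C g f \<in> hom C x z"
    and comp_idt: "f \<in> hom C x y \<Longrightarrow> Comp C f (Idt C x) = f"
    and idt_comp: "f \<in> hom C x y \<Longrightarrow> Comp C (Idt C y) f = f"
    and comp_assoc: "f \<in> hom C w x \<Longrightarrow> g \<in> hom C x y \<Longrightarrow> h \<in> hom C y z \<Longrightarrow>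
      Comp C h (Comp C g f) = Comp C (Comp C h g) f"

record ('o, 'a, 'p, 'b) ftor =
  on_obj :: "'o \<Rightarrow> 'p"
  on_arr :: "'a \<Rightarrow> 'b"

definition ftor_comp ::
  "('p, 'b, 'q, 'c) ftor \<Rightarrow> ('o, 'a, 'p, 'b) ftor \<Rightarrow> ('o, 'a, 'q, 'c) ftor" where
  "ftor_comp F D = \<lparr>on_obj = on_obj F \<circ> on_obj D, on_arr = on_arr F \<circ> on_arr D\<rparr>"

locale cfunctor = dom: category C + cod: category D
  for C :: "('o, 'a) cat" and D :: "('p, 'b) cat" +
  fixes F :: "('o, 'a, 'p, 'b) ftor"
  assumes map_obj: "x \<in> Obj C \<Longrightarrow> on_obj F x \<in> Obj D"
    and map_hom: "f \<in> hom C x y \<Longrightarrow> on_arr F f \<in> hom D (on_obj F x) (on_obj F y)"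
    and map_idt: "x \<in> Obj C \<Longrightarrow> on_arr F (Idt C x) = Idt D (on_obj F x)"
    and map_comp: "f \<in> hom C x y \<Longrightarrow> g \<in> hom C y z \<Longrightarrow>
      on_arr F (Comp C g f) = Comp D (on_arr F g) (on_arr F f)"

text \<open>\<open>G : D \<rightarrow> C\<close> is left adjoint to \<open>F : C \<rightarrow> D\<close>, with unit \<open>\<eta>\<close> and counit \<open>\<epsilon>\<close>.\<close>

locale adjunction = right: cfunctor C D F + left: cfunctor D C G
  for C :: "('o, 'a) cat" and D :: "('p, 'b) cat"
    and F :: "('o, 'a, 'p, 'b) ftor" and G :: "('p, 'b, 'o, 'a) ftor" +
  fixes \<eta> :: "'p \<Rightarrow> 'b" and \<epsilon> :: "'o \<Rightarrow> 'a"
  assumes unit_hom: "x' \<in> Obj D \<Longrightarrow> \<eta> x' \<in> hom D x' (on_obj F (on_obj G x'))"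
    and unit_nat: "f' \<in> hom D x' y' \<Longrightarrow>
      Comp D (\<eta> y') f' = Comp D (on_arr F (on_arr G f')) (\<eta> x')"
    and counit_hom: "x \<in> Obj C \<Longrightarrow> \<epsilon> x \<in> hom C (on_obj G (on_obj F x)) x"
    and counit_nat: "f \<in> hom C x y \<Longrightarrow>
      Comp C (\<epsilon> y) (on_arr G (on_arr F f)) = Comp C f (\<epsilon> x)"
    and triangle_left: "x' \<in> Obj D \<Longrightarrow>
      Comp C (\<epsilon> (on_obj G x')) (on_arr G (\<eta> x')) = Idt C (on_obj G x')"
    and triangle_right: "x \<in> Obj C \<Longrightarrow>
      Comp D (on_arr F (\<epsilon> x)) (\<eta> (on_obj F x)) = Idt D (on_obj F x)"

definition cone ::
  "('j, 'l) cat \<Rightarrow> ('o, 'a) cat \<Rightarrow> ('j, 'l, 'o, 'a) ftor \<Rightarrow> 'o \<Rightarrow> ('j \<Rightarrow> 'a) \<Rightarrow> bool" where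
  "cone J C X L l \<longleftrightarrow> L \<in> Obj C \<and>
    (\<forall>j\<in>Obj J. l j \<in> hom C L (on_obj X j)) \<and>
    (\<forall>u\<in>Arr J. Comp C (on_arr X u) (l (Dom J u)) = l (Cod J u))"

definition limit_cone ::
  "('j, 'l) cat \<Rightarrow> ('o, 'a) cat \<Rightarrow> ('j, 'l, 'o, 'a) ftor \<Rightarrow> 'o \<Rightarrow> ('j \<Rightarrow> 'a) \<Rightarrow> bool" where
  "limit_cone J C X L l \<longleftrightarrow> cone J C X L l \<and>
    (\<forall>L' l'. cone J C X L' l' \<longrightarrow>
      (\<exists>!u. u \<in> hom C L' L \<and> (\<forall>j\<in>Obj J. Comp C (l j) u = l' j)))"

definition preserves_limits ::
  "('j, 'l) cat \<Rightarrow> ('o, 'a) cat \<Rightarrow> ('p, 'b) cat \<Rightarrow> ('o, 'a, 'p, 'b) ftor \<Rightarrow> bool" where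
  "preserves_limits J C D F \<longleftrightarrow> (\<forall>X L l. cfunctor J C X \<longrightarrow> limit_cone J C X L l \<longrightarrow>
    limit_cone J D (ftor_comp F X) (on_obj F L) (on_arr F \<circ> l))"


section \<open>Regular categories and degree functions\<close>

definition monic :: "('o, 'a) cat \<Rightarrow> 'a \<Rightarrow> bool" where
  "monic C m \<longleftrightarrow> m \<in> Arr C \<and>
    (\<forall>w. \<forall>g\<in>hom C w (Dom C m). \<forall>h\<in>hom C w (Dom C m). Comp C m g = Comp C m h \<longrightarrow> g = h)"

definition epic :: "('o, 'a) cat \<Rightarrow> 'a \<Rightarrow> bool" where
  "epic C e \<longleftrightarrow> e \<in> Arr C \<and>
    (\<forall>w. \<forall>g\<in>hom C (Cod C e) w. \<forall>h\<in>hom C (Cod C e) w. Comp C g e = Comp C h e \<longrightarrow> g = h)"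

definition is_iso :: "('o, 'a) cat \<Rightarrow> 'a \<Rightarrow> bool" where
  "is_iso C f \<longleftrightarrow> f \<in> Arr C \<and>
    (\<exists>g\<in>hom C (Cod C f) (Dom C f).
      Comp C g f = Idt C (Dom C f) \<and> Comp C f g = Idt C (Cod C f))"

definition terminal :: "('o, 'a) cat \<Rightarrow> 'o \<Rightarrow> bool" where
  "terminal C t \<longleftrightarrow> t \<in> Obj C \<and> (\<forall>x\<in>Obj C. \<exists>!f. f \<in> hom C x t)"

text \<open>
  Cospan \<open>f : x \<rightarrow> z \<leftarrow> y : g\<close>, completed by \<open>p : w \<rightarrow> x\<close> and \<open>q : w \<rightarrow> y\<close>;
  so \<open>q\<close> is the pullback of \<open>f\<close> along \<open>g\<close>.
\<close>

definition comm_square :: "('o, 'a) cat \<Rightarrow> 'a \<Rightarrow> 'a \<Rightarrow> 'a \<Rightarrow> 'a \<Rightarrow> bool" where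
  "comm_square C f g p q \<longleftrightarrow> f \<in> Arr C \<and> g \<in> Arr C \<and> p \<in> Arr C \<and> q \<in> Arr C \<and>
    Cod C f = Cod C g \<and> Dom C p = Dom C q \<and> Cod C p = Dom C f \<and> Cod C q = Dom C g \<and>
    Comp C f p = Comp C g q"

definition is_pullback :: "('o, 'a) cat \<Rightarrow> 'a \<Rightarrow> 'a \<Rightarrow> 'a \<Rightarrow> 'a \<Rightarrow> bool" where
  "is_pullback C f g p q \<longleftrightarrow> comm_square C f g p q \<and>
    (\<forall>p' q'. comm_square C f g p' q' \<longrightarrow>
      (\<exists>!u. u \<in> hom C (Dom C p') (Dom C p) \<and> Comp C p u = p' \<and> Comp C q u = q'))"

definition has_pullback :: "('o, 'a) cat \<Rightarrow> 'a \<Rightarrow> 'a \<Rightarrow> bool" where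
  "has_pullback C f g \<longleftrightarrow> (\<exists>p q. is_pullback C f g p q)"

definition epi_mono_fact :: "('o, 'a) cat \<Rightarrow> 'a \<Rightarrow> 'a \<Rightarrow> 'a \<Rightarrow> bool" where
  "epi_mono_fact C f e m \<longleftrightarrow> epic C e \<and> monic C m \<and> Cod C e = Dom C m \<and> Comp C m e = f"

locale regular_category = category C for C :: "('o, 'a) cat" +
  assumes terminal_exists: "\<exists>t. terminal C t"
    and image_exists: "f \<in> Arr C \<Longrightarrow> \<exists>e m. epi_mono_fact C f e m"
    and image_unique: "epi_mono_fact C f e m \<Longrightarrow> epi_mono_fact C f e' m' \<Longrightarrow>
      \<exists>i \<in> hom C (Cod C e) (Cod C e'). is_iso C i \<and> Comp C i e = e' \<and> Comp C m' i = m"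
    and pullback_exists: "comm_square C f g p q \<Longrightarrow> has_pullback C f g"
    and epi_pullback_exists: "epic C f \<Longrightarrow> g \<in> Arr C \<Longrightarrow> Cod C g = Cod C f \<Longrightarrow> has_pullback C f g"
    and epi_pullback: "is_pullback C f g p q \<Longrightarrow> epic C f \<Longrightarrow> epic C q"

text \<open>Only the values of \<open>\<delta>\<close> on epimorphisms matter.\<close>

locale degree_function = category C for C :: "('o, 'a) cat" +
  fixes \<delta> :: "'a \<Rightarrow> 'k::field"
  assumes degree_idt: "x \<in> Obj C \<Longrightarrow> \<delta> (Idt C x) = 1"
    and degree_comp: "epic C e \<Longrightarrow> epic C e' \<Longrightarrow> Cod C e = Dom C e' \<Longrightarrow>
      \<delta> (Comp C e' e) = \<delta> e' * \<delta> e"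
    and degree_pullback: "epic C f \<Longrightarrow> is_pullback C f g p q \<Longrightarrow> \<delta> q = \<delta> f"

definition preserves_degree ::
  "('o, 'a) cat \<Rightarrow> ('a \<Rightarrow> 'k::field) \<Rightarrow> ('p, 'b) cat \<Rightarrow> ('b \<Rightarrow> 'k) \<Rightarrow> ('o, 'a, 'p, 'b) ftor \<Rightarrow> bool"
  where
  "preserves_degree C \<delta> D \<delta>' F \<longleftrightarrow>
    (\<forall>e. epic C e \<longrightarrow> epic D (on_arr F e) \<and> \<delta>' (on_arr F e) = \<delta> e)"

text \<open>
  Pullbacks in a regular category may fail to exist, and the composition in \<open>\<T>\<^sup>0\<close> below treats
  a missing pullback as \<open>0\<close>. Preservation of pullbacks therefore covers their non-existence too:
  \<open>F x \<times>\<^bsub>F z\<^esub> F y\<close> exists only if \<open>x \<times>\<^bsub>z\<^esub> y\<close> does. Without this,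
  \<open>\<langle>r\<rangle> \<mapsto> \<langle>F r\<rangle>\<close> would not be compatible with composition.
\<close>

definition preserves_pullbacks ::
  "('o, 'a) cat \<Rightarrow> ('p, 'b) cat \<Rightarrow> ('o, 'a, 'p, 'b) ftor \<Rightarrow> bool" where
  "preserves_pullbacks C D F \<longleftrightarrow>
    (\<forall>f g p q. is_pullback C f g p q \<longrightarrow>
      is_pullback D (on_arr F f) (on_arr F g) (on_arr F p) (on_arr F q)) \<and>
    (\<forall>f\<in>Arr C. \<forall>g\<in>Arr C. Cod C f = Cod C g \<longrightarrow>
      has_pullback D (on_arr F f) (on_arr F g) \<longrightarrow> has_pullback C f g)"


section \<open>Products, subobjects, relations\<close>

definition is_product :: "('o, 'a) cat \<Rightarrow> 'o \<Rightarrow> 'o \<Rightarrow> 'a \<Rightarrow> 'a \<Rightarrow> bool" where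
  "is_product C x y p q \<longleftrightarrow> p \<in> Arr C \<and> q \<in> Arr C \<and> Dom C p = Dom C q \<and> Cod C p = x \<and> Cod C q = y \<and>
    (\<forall>w. \<forall>f\<in>hom C w x. \<forall>g\<in>hom C w y.
      \<exists>!u. u \<in> hom C w (Dom C p) \<and> Comp C p u = f \<and> Comp C q u = g)"

definition has_product :: "('o, 'a) cat \<Rightarrow> 'o \<Rightarrow> 'o \<Rightarrow> bool" where
  "has_product C x y \<longleftrightarrow> (\<exists>p q. is_product C x y p q)"

definition prod_cone :: "('o, 'a) cat \<Rightarrow> 'o \<Rightarrow> 'o \<Rightarrow> 'a \<times> 'a" where
  "prod_cone C x y = (SOME pq. is_product C x y (fst pq) (snd pq))"

definition pr1 :: "('o, 'a) cat \<Rightarrow> 'o \<Rightarrow> 'o \<Rightarrow> 'a" where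
  "pr1 C x y = fst (prod_cone C x y)"

definition pr2 :: "('o, 'a) cat \<Rightarrow> 'o \<Rightarrow> 'o \<Rightarrow> 'a" where
  "pr2 C x y = snd (prod_cone C x y)"

definition prod_obj :: "('o, 'a) cat \<Rightarrow> 'o \<Rightarrow> 'o \<Rightarrow> 'o" where
  "prod_obj C x y = Dom C (pr1 C x y)"

text \<open>The arrow \<open>(f, g) : w \<rightarrow> x \<times> y\<close> for \<open>f : w \<rightarrow> x\<close> and \<open>g : w \<rightarrow> y\<close>.\<close>

definition pairing :: "('o, 'a) cat \<Rightarrow> 'o \<Rightarrow> 'o \<Rightarrow> 'a \<Rightarrow> 'a \<Rightarrow> 'a" where
  "pairing C x y f g = (THE u. u \<in> hom C (Dom C f) (prod_obj C x y) \<and>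
    Comp C (pr1 C x y) u = f \<and> Comp C (pr2 C x y) u = g)"

text \<open>A subobject is an isomorphism class of monomorphisms with a given codomain.\<close>

definition subobj :: "('o, 'a) cat \<Rightarrow> 'a \<Rightarrow> 'a set" where
  "subobj C m = {m'. monic C m' \<and> Cod C m' = Cod C m \<and>
    (\<exists>i \<in> hom C (Dom C m') (Dom C m). is_iso C i \<and> Comp C m i = m')}"

definition subobjects :: "('o, 'a) cat \<Rightarrow> 'o \<Rightarrow> 'a set set" where
  "subobjects C x = {subobj C m | m. monic C m \<and> Cod C m = x}"

definition relations :: "('o, 'a) cat \<Rightarrow> 'o \<Rightarrow> 'o \<Rightarrow> 'a set set" where
  "relations C x y = (if has_product C x y then subobjects C (prod_obj C x y) else {})"

definition rel_rep :: "'a set \<Rightarrow> 'a" where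
  "rel_rep r = (SOME m. m \<in> r)"

definition src_leg :: "('o, 'a) cat \<Rightarrow> 'o \<Rightarrow> 'o \<Rightarrow> 'a set \<Rightarrow> 'a" where
  "src_leg C x y r = Comp C (pr1 C x y) (rel_rep r)"

definition tgt_leg :: "('o, 'a) cat \<Rightarrow> 'o \<Rightarrow> 'o \<Rightarrow> 'a set \<Rightarrow> 'a" where
  "tgt_leg C x y r = Comp C (pr2 C x y) (rel_rep r)"

text \<open>For \<open>r \<subseteq> x \<times> y\<close> and \<open>s \<subseteq> y \<times> z\<close>: existence of \<open>r \<times>\<^bsub>y\<^esub> s\<close>, its projections,
  the arrow \<open>r \<times>\<^bsub>y\<^esub> s \<rightarrow> x \<times> z\<close> and its image factorization.\<close>

definition rel_pullback_exists :: "('o, 'a) cat \<Rightarrow> 'o \<Rightarrow> 'o \<Rightarrow> 'o \<Rightarrow> 'a set \<Rightarrow> 'a set \<Rightarrow> bool" where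
  "rel_pullback_exists C x y z r s = has_pullback C (tgt_leg C x y r) (src_leg C y z s)"

definition rel_pullback :: "('o, 'a) cat \<Rightarrow> 'o \<Rightarrow> 'o \<Rightarrow> 'o \<Rightarrow> 'a set \<Rightarrow> 'a set \<Rightarrow> 'a \<times> 'a" where
  "rel_pullback C x y z r s =
    (SOME pq. is_pullback C (tgt_leg C x y r) (src_leg C y z s) (fst pq) (snd pq))"

definition rel_span :: "('o, 'a) cat \<Rightarrow> 'o \<Rightarrow> 'o \<Rightarrow> 'o \<Rightarrow> 'a set \<Rightarrow> 'a set \<Rightarrow> 'a" where
  "rel_span C x y z r s = (let (p, q) = rel_pullback C x y z r s in
    pairing C x z (Comp C (src_leg C x y r) p) (Comp C (tgt_leg C y z s) q))"

definition rel_fact :: "('o, 'a) cat \<Rightarrow> 'o \<Rightarrow> 'o \<Rightarrow> 'o \<Rightarrow> 'a set \<Rightarrow> 'a set \<Rightarrow> 'a \<times> 'a" where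
  "rel_fact C x y z r s =
    (SOME em. epi_mono_fact C (rel_span C x y z r s) (fst em) (snd em))"

definition rel_epi :: "('o, 'a) cat \<Rightarrow> 'o \<Rightarrow> 'o \<Rightarrow> 'o \<Rightarrow> 'a set \<Rightarrow> 'a set \<Rightarrow> 'a" where
  "rel_epi C x y z r s = fst (rel_fact C x y z r s)"

definition rel_star :: "('o, 'a) cat \<Rightarrow> 'o \<Rightarrow> 'o \<Rightarrow> 'o \<Rightarrow> 'a set \<Rightarrow> 'a set \<Rightarrow> 'a set" where
  "rel_star C x y z r s = subobj C (snd (rel_fact C x y z r s))"


section \<open>Additive and Karoubi completion\<close>

text \<open>
  A category enriched in commutative monoids, given by its family of (not necessarily disjoint)
  hom sets. \<open>LComp C x y z g f\<close> is \<open>g \<circ> f\<close> for \<open>f : x \<rightarrow> y\<close> and \<open>g : y \<rightarrow> z\<close>.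
\<close>

record ('o, 'm) lincat =
  LObj :: "'o set"
  LHom :: "'o \<Rightarrow> 'o \<Rightarrow> 'm set"
  LIdt :: "'o \<Rightarrow> 'm"
  LComp :: "'o \<Rightarrow> 'o \<Rightarrow> 'o \<Rightarrow> 'm \<Rightarrow> 'm \<Rightarrow> 'm"

text \<open>
  Objects are finite formal direct sums and arrows are matrices, tagged with source and target.
  The entry \<open>M i j\<close> goes from the \<open>j\<close>-th summand of the source to the \<open>i\<close>-th summand of the
  target; entries outside the index range are \<open>0\<close>, so that matrices are determined by their entries.
\<close>

type_synonym ('o, 'm) matrix_arr = "'o list \<times> (nat \<Rightarrow> nat \<Rightarrow> 'm) \<times> 'o list"

definition add_completion ::
  "('o, 'm::comm_monoid_add) lincat \<Rightarrow> ('o list, ('o, 'm) matrix_arr) cat" where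
  "add_completion C = \<lparr>
    Obj = lists (LObj C),
    Arr = {(xs, M, ys). xs \<in> lists (LObj C) \<and> ys \<in> lists (LObj C) \<and>
      (\<forall>i j. if i < length ys \<and> j < length xs then M i j \<in> LHom C (xs ! j) (ys ! i)
             else M i j = 0)},
    Dom = (\<lambda>(xs, M, ys). xs),
    Cod = (\<lambda>(xs, M, ys). ys),
    Idt = (\<lambda>xs. (xs, \<lambda>i j. if i = j \<and> i < length xs then LIdt C (xs ! i) else 0, xs)),
    Comp = (\<lambda>(ys, N, zs) (xs, M, _). (xs,
      \<lambda>i j. if i < length zs \<and> j < length xs
        then \<Sum>k<length ys. LComp C (xs ! j) (ys ! k) (zs ! i) (N i k) (M k j) else 0, zs))\<rparr>"

definition add_ftor ::
  "('o \<Rightarrow> 'p) \<Rightarrow> ('o \<Rightarrow> 'o \<Rightarrow> 'm \<Rightarrow> 'n::comm_monoid_add) \<Rightarrow>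
    ('o list, ('o, 'm) matrix_arr, 'p list, ('p, 'n) matrix_arr) ftor" where
  "add_ftor fo fm = \<lparr>
    on_obj = map fo,
    on_arr = (\<lambda>(xs, M, ys). (map fo xs,
      \<lambda>i j. if i < length ys \<and> j < length xs then fm (xs ! j) (ys ! i) (M i j) else 0, map fo ys))\<rparr>"

type_synonym ('o, 'a) karoubi_arr = "('o \<times> 'a) \<times> 'a \<times> ('o \<times> 'a)"

definition karoubi :: "('o, 'a) cat \<Rightarrow> ('o \<times> 'a, ('o, 'a) karoubi_arr) cat" where
  "karoubi C = (let Ob = {(x, e). x \<in> Obj C \<and> e \<in> hom C x x \<and> Comp C e e = e} in \<lparr>
    Obj = Ob,
    Arr = {((x, e), f, (y, d)). (x, e) \<in> Ob \<and> (y, d) \<in> Ob \<and> f \<in> hom C x y \<and>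
      Comp C d f = f \<and> Comp C f e = f},
    Dom = (\<lambda>(X, f, Y). X),
    Cod = (\<lambda>(X, f, Y). Y),
    Idt = (\<lambda>(x, e). ((x, e), e, (x, e))),
    Comp = (\<lambda>(_, g, Z) (X, f, _). (X, Comp C g f, Z))\<rparr>)"

definition karoubi_ftor ::
  "('o, 'a, 'p, 'b) ftor \<Rightarrow>
    ('o \<times> 'a, ('o, 'a) karoubi_arr, 'p \<times> 'b, ('p, 'b) karoubi_arr) ftor" where
  "karoubi_ftor F = (let fo = map_prod (on_obj F) (on_arr F) in \<lparr>
    on_obj = fo,
    on_arr = (\<lambda>(X, f, Y). (fo X, on_arr F f, fo Y))\<rparr>)"


section \<open>The categories \<open>\<T>\<^sup>0\<close> and \<open>\<T>\<close>, and induced functors\<close>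

text \<open>The formal linear combinations are the finitely supported functions on relations;
  \<open>\<langle>r\<rangle>\<close> is \<open>Poly_Mapping.single r 1\<close>.\<close>

definition T0 ::
  "('o, 'a) cat \<Rightarrow> ('a \<Rightarrow> 'k::field) \<Rightarrow> ('o, 'a set \<Rightarrow>\<^sub>0 'k) lincat" where
  "T0 C \<delta> = \<lparr>
    LObj = Obj C,
    LHom = (\<lambda>x y. {a. Poly_Mapping.keys a \<subseteq> relations C x y}),
    LIdt = (\<lambda>x. Poly_Mapping.single (subobj C (pairing C x x (Idt C x) (Idt C x))) 1),
    LComp = (\<lambda>x y z b a. \<Sum>r\<in>Poly_Mapping.keys a. \<Sum>s\<in>Poly_Mapping.keys b.
      if rel_pullback_exists C x y z r s
      then Poly_Mapping.single (rel_star C x y z r s)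
        (Poly_Mapping.lookup b s * Poly_Mapping.lookup a r * \<delta> (rel_epi C x y z r s))
      else 0)\<rparr>"

type_synonym ('o, 'a, 'k) T_obj = "'o list \<times> ('o, 'a set \<Rightarrow>\<^sub>0 'k) matrix_arr"
type_synonym ('o, 'a, 'k) T_arr = "('o list, ('o, 'a set \<Rightarrow>\<^sub>0 'k) matrix_arr) karoubi_arr"

definition T ::
  "('o, 'a) cat \<Rightarrow> ('a \<Rightarrow> 'k::field) \<Rightarrow> (('o, 'a, 'k) T_obj, ('o, 'a, 'k) T_arr) cat" where
  "T C \<delta> = karoubi (add_completion (T0 C \<delta>))"

text \<open>\<open>F r\<close> as a subobject of \<open>F x \<times> F y\<close>, via \<open>F (x \<times> y) \<rightarrow> F x \<times> F y\<close>.\<close>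

definition rel_image ::
  "('o, 'a) cat \<Rightarrow> ('p, 'b) cat \<Rightarrow> ('o, 'a, 'p, 'b) ftor \<Rightarrow> 'o \<Rightarrow> 'o \<Rightarrow> 'a set \<Rightarrow> 'b set" where
  "rel_image C D F x y r = subobj D
    (Comp D
      (pairing D (on_obj F x) (on_obj F y) (on_arr F (pr1 C x y)) (on_arr F (pr2 C x y)))
      (on_arr F (rel_rep r)))"

definition T0_map ::
  "('o, 'a) cat \<Rightarrow> ('p, 'b) cat \<Rightarrow> ('o, 'a, 'p, 'b) ftor \<Rightarrow> 'o \<Rightarrow> 'o \<Rightarrow>
    ('a set \<Rightarrow>\<^sub>0 'k::field) \<Rightarrow> ('b set \<Rightarrow>\<^sub>0 'k)" where
  "T0_map C D F x y a = (\<Sum>r\<in>Poly_Mapping.keys a.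
    Poly_Mapping.single (rel_image C D F x y r) (Poly_Mapping.lookup a r))"

definition T_ftor ::
  "('o, 'a) cat \<Rightarrow> ('p, 'b) cat \<Rightarrow> ('o, 'a, 'p, 'b) ftor \<Rightarrow>
    (('o, 'a, 'k::field) T_obj, ('o, 'a, 'k) T_arr, ('p, 'b, 'k) T_obj, ('p, 'b, 'k) T_arr) ftor"
  where
  "T_ftor C D F = karoubi_ftor (add_ftor (on_obj F) (T0_map C D F))"

end

(*
  Each functor preserving degrees and pullbacks induces a functor on \<open>\<T>\<close>, and F preserves pullbacks
  because it is a right adjoint; a pullback of F f and F g transposes to a commutative square over f and g,
  so F also reflects the existence of pullbacks. The graphs of \<open>\<eta>\<close> and \<open>\<epsilon>\<close> inherit the triangle
  identities, and the two Cartesian squares say exactly that they remain natural with respect to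
  relations. Hence the functor induced by F is right adjoint to the one induced by G.
*)
theory Submission
  imports Defs
begin

text \<open>The obstacle is that composition in \<open>T0\<close> takes an image and weights it by a
  degree, which makes associativity and functoriality unwieldy on relations themselves. An arbitrary
  span with image epimorphism e is therefore given the weight c * \<delta> e. Degrees multiply under
  composition and are stable under pullback, so with this weight two spans compose to their plain
  pullback span, with the product of the coefficients. A relation is a span with jointly monic legs,
  every span is a multiple of a relation, and identities are checked on spans and extended by
  additivity.

  Since a missing pullback counts as zero, each identity also needs an existence argument: both
  sides must vanish together. These arguments rest on the axiom that a cospan with some commutative
  completion has a pullback.

  Graphs behave asymmetrically. Composing with a graph afterwards changes one leg only; composing
  with it beforehand needs a genuine pullback, and this is what a Cartesian naturality square
  supplies. The passage from \<open>T0\<close> through matrices and idempotents is formal.\<close>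

lemma homI: "f \<in> Arr C \<Longrightarrow> Dom C f = x \<Longrightarrow> Cod C f = y \<Longrightarrow> f \<in> hom C x y"
  and homD: "f \<in> hom C x y \<Longrightarrow> f \<in> Arr C" "f \<in> hom C x y \<Longrightarrow> Dom C f = x"
    "f \<in> hom C x y \<Longrightarrow> Cod C f = y"
  by (auto simp: hom_def)

lemma (in category) hom_obj:
  assumes "f \<in> hom C x y" shows "x \<in> Obj C" "y \<in> Obj C"
  using assms dom_obj cod_obj by (auto simp: hom_def)

section \<open>Right adjoints preserve limits\<close>

context adjunction begin

definition transpose :: "'o \<Rightarrow> 'b \<Rightarrow> 'a" where
  "transpose x g = Comp C (\<epsilon> x) (on_arr G g)"

lemma transpose_hom:
  "x \<in> Obj C \<Longrightarrow> g \<in> hom D v (on_obj F x) \<Longrightarrow> transpose x g \<in> hom C (on_obj G v) x"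
  unfolding transpose_def by (rule right.dom.comp_hom[OF left.map_hom counit_hom])

text \<open>Naturality of \<open>\<epsilon>\<close> along \<open>f\<close>. It is what turns cones
  over \<open>ftor_comp F X\<close> into cones over \<open>X\<close>, and commutative squares over
  \<open>F f\<close>, \<open>F g\<close> into squares over \<open>f\<close>,
  \<open>g\<close>.\<close>

lemma comp_transpose:
  assumes f: "f \<in> hom C x y" and g: "g \<in> hom D v (on_obj F x)"
  shows "Comp C f (transpose x g) = transpose y (Comp D (on_arr F f) g)"
proof -
  note xy = right.dom.hom_obj[OF f] and Ff = right.map_hom[OF f]
  have "Comp C f (transpose x g) = Comp C (Comp C (\<epsilon> y) (on_arr G (on_arr F f))) (on_arr G g)"
    unfolding transpose_def counit_nat[OF f]
    by (rule right.dom.comp_assoc[OF left.map_hom[OF g] counit_hom[OF xy(1)] f])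
  also have "\<dots> = transpose y (Comp D (on_arr F f) g)"
    unfolding transpose_def left.map_comp[OF g Ff]
    by (rule right.dom.comp_assoc[OF left.map_hom[OF g] left.map_hom[OF Ff] counit_hom[OF xy(2)], symmetric])
  finally show ?thesis .
qed

lemma untranspose_hom:
  "v \<in> Obj D \<Longrightarrow> u \<in> hom C (on_obj G v) x \<Longrightarrow> Comp D (on_arr F u) (\<eta> v) \<in> hom D v (on_obj F x)"
  by (rule right.cod.comp_hom[OF unit_hom right.map_hom])

lemma comp_untranspose:
  assumes "v \<in> Obj D" "u \<in> hom C (on_obj G v) x" "f \<in> hom C x y"
  shows "Comp D (on_arr F f) (Comp D (on_arr F u) (\<eta> v)) = Comp D (on_arr F (Comp C f u)) (\<eta> v)"
  using right.cod.comp_assoc[OF unit_hom[OF assms(1)] right.map_hom[OF assms(2)] right.map_hom[OF assms(3)]]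
    right.map_comp[OF assms(2,3)] by simp

text \<open>Naturality of \<open>\<eta>\<close> moves \<open>g\<close> past the unit, and
  \<open>triangle_right\<close> removes the remaining factor. The resulting injectivity of
  \<open>transpose\<close> yields the uniqueness of mediating arrows below.\<close>

lemma untranspose_transpose:
  assumes x: "x \<in> Obj C" and g: "g \<in> hom D v (on_obj F x)"
  shows "Comp D (on_arr F (transpose x g)) (\<eta> v) = g"
proof -
  have v: "v \<in> Obj D" by (rule right.cod.hom_obj[OF g])
  note Fe = right.map_hom[OF counit_hom[OF x]] and Gg = left.map_hom[OF g]
  have "Comp D (on_arr F (transpose x g)) (\<eta> v) =
      Comp D (on_arr F (\<epsilon> x)) (Comp D (on_arr F (on_arr G g)) (\<eta> v))"
    unfolding transpose_def right.map_comp[OF Gg counit_hom[OF x]]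
    by (rule right.cod.comp_assoc[OF unit_hom[OF v] right.map_hom[OF Gg] Fe, symmetric])
  also have "\<dots> = Comp D (Comp D (on_arr F (\<epsilon> x)) (\<eta> (on_obj F x))) g"
    unfolding unit_nat[OF g, symmetric]
    by (rule right.cod.comp_assoc[OF g unit_hom[OF right.map_obj[OF x]] Fe])
  also have "\<dots> = g" by (simp add: triangle_right[OF x] right.cod.idt_comp[OF g])
  finally show ?thesis .
qed

lemma right_adjoint_preserves_limits: "preserves_limits J C D F"
  unfolding preserves_limits_def
proof (intro allI impI)
  fix X :: "('c, 'd, 'o, 'a) ftor" and L l
  assume X: "cfunctor J C X" and lim: "limit_cone J C X L l"
  interpret X: cfunctor J C X by (rule X)
  have L: "L \<in> Obj C" and l: "\<And>j. j \<in> Obj J \<Longrightarrow> l j \<in> hom C L (on_obj X j)"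
    and lnat: "\<And>u. u \<in> Arr J \<Longrightarrow> Comp C (on_arr X u) (l (Dom J u)) = l (Cod J u)"
    using lim by (auto simp: limit_cone_def cone_def)
  have Xu: "on_arr X u \<in> hom C (on_obj X (Dom J u)) (on_obj X (Cod J u))" if "u \<in> Arr J" for u
    using X.map_hom[OF homI] that by blast
  have cone: "cone J D (ftor_comp F X) (on_obj F L) (on_arr F \<circ> l)"
    unfolding cone_def
  proof (intro conjI ballI)
    show "on_obj F L \<in> Obj D" using L by (rule right.map_obj)
    show "(on_arr F \<circ> l) j \<in> hom D (on_obj F L) (on_obj (ftor_comp F X) j)" if "j \<in> Obj J" for j
      using right.map_hom[OF l[OF that]] by (simp add: ftor_comp_def)
    show "Comp D (on_arr (ftor_comp F X) u) ((on_arr F \<circ> l) (Dom J u)) = (on_arr F \<circ> l) (Cod J u)"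
      if u: "u \<in> Arr J" for u
      using right.map_comp[OF l Xu[OF u]] lnat[OF u] X.dom.dom_obj[OF u]
      by (simp add: ftor_comp_def)
  qed
  have univ: "\<exists>!v. v \<in> hom D L' (on_obj F L) \<and> (\<forall>j\<in>Obj J. Comp D ((on_arr F \<circ> l) j) v = l' j)"
    if c: "cone J D (ftor_comp F X) L' l'" for L' l'
  proof -
    have L': "L' \<in> Obj D"
      and l': "\<And>j. j \<in> Obj J \<Longrightarrow> l' j \<in> hom D L' (on_obj F (on_obj X j))"
      and l'nat: "\<And>u. u \<in> Arr J \<Longrightarrow> Comp D (on_arr F (on_arr X u)) (l' (Dom J u)) = l' (Cod J u)"
      using c by (auto simp: cone_def ftor_comp_def)
    \<comment> \<open>The transposed legs form a cone over \<open>X\<close> with apex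
      \<open>G L'\<close>, to which the limit property in \<open>C\<close> applies.\<close>
    define k where "k j = transpose (on_obj X j) (l' j)" for j
    have "cone J C X (on_obj G L') k"
      unfolding cone_def
    proof (intro conjI ballI)
      show "on_obj G L' \<in> Obj C" using L' by (rule left.map_obj)
      show "k j \<in> hom C (on_obj G L') (on_obj X j)" if "j \<in> Obj J" for j
        unfolding k_def using transpose_hom[OF X.map_obj l'] that by blast
      show "Comp C (on_arr X u) (k (Dom J u)) = k (Cod J u)" if u: "u \<in> Arr J" for u
        using comp_transpose[OF Xu[OF u] l'[OF X.dom.dom_obj[OF u]]] l'nat[OF u] by (simp add: k_def)
    qed
    then obtain u where u: "u \<in> hom C (on_obj G L') L" "\<And>j. j \<in> Obj J \<Longrightarrow> Comp C (l j) u = k j"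
      and uniq: "\<And>u'. u' \<in> hom C (on_obj G L') L \<Longrightarrow> (\<forall>j\<in>Obj J. Comp C (l j) u' = k j) \<Longrightarrow> u' = u"
      using lim unfolding limit_cone_def by metis
    define v where "v = Comp D (on_arr F u) (\<eta> L')"
    show ?thesis
    proof (rule ex1I[of _ v])
      have "Comp D (on_arr F (l j)) v = l' j" if j: "j \<in> Obj J" for j
        unfolding v_def comp_untranspose[OF L' u(1) l[OF j]] u(2)[OF j] k_def
        by (rule untranspose_transpose[OF X.map_obj[OF j] l'[OF j]])
      then show "v \<in> hom D L' (on_obj F L) \<and> (\<forall>j\<in>Obj J. Comp D ((on_arr F \<circ> l) j) v = l' j)"
        using untranspose_hom[OF L' u(1)] by (simp add: v_def)
      fix v' assume v': "v' \<in> hom D L' (on_obj F L) \<and> (\<forall>j\<in>Obj J. Comp D ((on_arr F \<circ> l) j) v' = l' j)"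
      then have h: "v' \<in> hom D L' (on_obj F L)" by blast
      \<comment> \<open>The transpose of a competitor mediates the same transposed cone, so
        uniqueness in \<open>C\<close> identifies it with \<open>u\<close>.\<close>
      have "transpose L v' = u"
        using v' comp_transpose[OF l h] by (intro uniq transpose_hom[OF L h]) (simp add: k_def)
      then show "v' = v" using untranspose_transpose[OF L h] by (simp add: v_def)
    qed
  qed
  show "limit_cone J D (ftor_comp F X) (on_obj F L) (on_arr F \<circ> l)"
    unfolding limit_cone_def using cone univ by blast
qed

end

section \<open>The Karoubi envelope\<close>

lemma karoubi_obj: "(x, e) \<in> Obj (karoubi C) \<longleftrightarrow> x \<in> Obj C \<and> e \<in> hom C x x \<and> Comp C e e = e"
  by (simp add: karoubi_def Let_def)

lemma karoubi_arr: "((x, e), f, (y, d)) \<in> Arr (karoubi C) \<longleftrightarrow>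
    (x, e) \<in> Obj (karoubi C) \<and> (y, d) \<in> Obj (karoubi C) \<and> f \<in> hom C x y \<and> 
    Comp C d f = f \<and> Comp C f e = f"
  by (simp add: karoubi_def Let_def)

lemma karoubi_sel [simp]:
  "Dom (karoubi C) (X, f, Y) = X" "Cod (karoubi C) (X, f, Y) = Y"
  "Idt (karoubi C) (x, e) = ((x, e), e, (x, e))"
  "Comp (karoubi C) (Y', g, Z) (X, f, Y) = (X, Comp C g f, Z)"
  by (simp_all add: karoubi_def Let_def)

lemma karoubi_hom: "\<phi> \<in> hom (karoubi C) (x, e) (y, d) \<longleftrightarrow>
    (\<exists>f. \<phi> = ((x, e), f, (y, d)) \<and> (x, e) \<in> Obj (karoubi C) \<and> (y, d) \<in> Obj (karoubi C) \<and>
      f \<in> hom C x y \<and> Comp C d f = f \<and> Comp C f e = f)"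
  unfolding hom_def[of "karoubi C"] by (cases \<phi>) (auto simp: karoubi_arr)

lemma (in category) karoubi_category: "category (karoubi C)"
proof
  fix \<phi> assume "\<phi> \<in> Arr (karoubi C)"
  moreover obtain x e f y d where "\<phi> = ((x, e), f, (y, d))" by (metis prod.exhaust)
  ultimately show "Dom (karoubi C) \<phi> \<in> Obj (karoubi C)" "Cod (karoubi C) \<phi> \<in> Obj (karoubi C)"
    by (auto simp: karoubi_arr)
next
  fix X assume "X \<in> Obj (karoubi C)"
  then show "Idt (karoubi C) X \<in> hom (karoubi C) X X"
    by (cases X) (auto simp: karoubi_hom karoubi_obj)
next
  fix \<phi> \<psi> X Y Z assume "\<phi> \<in> hom (karoubi C) X Y" "\<psi> \<in> hom (karoubi C) Y Z"
  then show "Comp (karoubi C) \<psi> \<phi> \<in> hom (karoubi C) X Z"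
    by (cases X; cases Y; cases Z) (auto simp: karoubi_hom karoubi_obj comp_assoc comp_hom,
        metis comp_assoc)
next
  fix \<phi> X Y assume "\<phi> \<in> hom (karoubi C) X Y"
  then show "Comp (karoubi C) \<phi> (Idt (karoubi C) X) = \<phi>" "Comp (karoubi C) (Idt (karoubi C) Y) \<phi> = \<phi>"
    by (cases X; cases Y; auto simp: karoubi_hom)+
next
  fix \<phi> \<psi> \<chi> W X Y Z
  assume "\<phi> \<in> hom (karoubi C) W X" "\<psi> \<in> hom (karoubi C) X Y" "\<chi> \<in> hom (karoubi C) Y Z"
  then show "Comp (karoubi C) \<chi> (Comp (karoubi C) \<psi> \<phi>) = Comp (karoubi C) (Comp (karoubi C) \<chi> \<psi>) \<phi>"
    by (cases W; cases X; cases Y; cases Z) (auto simp: karoubi_hom comp_assoc)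
qed

lemma karoubi_ftor_sel [simp]:
  "on_obj (karoubi_ftor F) (x, e) = (on_obj F x, on_arr F e)"
  "on_arr (karoubi_ftor F) ((x, e), f, (y, d)) =
    ((on_obj F x, on_arr F e), on_arr F f, (on_obj F y, on_arr F d))"
  by (simp_all add: karoubi_ftor_def Let_def)

section \<open>Functors between Karoubi envelopes\<close>

context cfunctor begin

lemma karoubi_map_obj: "(x, e) \<in> Obj (karoubi C) \<Longrightarrow> (on_obj F x, on_arr F e) \<in> Obj (karoubi D)"
  using map_comp[of e x x e x] by (auto simp: karoubi_obj map_obj map_hom)

lemma karoubi_cfunctor: "cfunctor (karoubi C) (karoubi D) (karoubi_ftor F)"
proof (intro cfunctor.intro cfunctor_axioms.intro)
  show "category (karoubi C)" "category (karoubi D)"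
    using dom.karoubi_category cod.karoubi_category by auto
next
  fix X assume "X \<in> Obj (karoubi C)"
  then show "on_obj (karoubi_ftor F) X \<in> Obj (karoubi D)"
    by (cases X) (auto simp: karoubi_map_obj)
next
  fix \<phi> X Y assume "\<phi> \<in> hom (karoubi C) X Y"
  moreover obtain x e where X: "X = (x, e)" by (cases X)
  moreover obtain y d where Y: "Y = (y, d)" by (cases Y)
  ultimately obtain f where f: "\<phi> = ((x, e), f, (y, d))" "(x, e) \<in> Obj (karoubi C)"
    "(y, d) \<in> Obj (karoubi C)" "f \<in> hom C x y" "Comp C d f = f" "Comp C f e = f"
    by (auto simp: karoubi_hom)
  then have "Comp D (on_arr F d) (on_arr F f) = on_arr F f" "Comp D (on_arr F f) (on_arr F e) = on_arr F f"
    by (metis karoubi_obj map_comp)+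
  then show "on_arr (karoubi_ftor F) \<phi> \<in> hom (karoubi D) (on_obj (karoubi_ftor F) X) (on_obj (karoubi_ftor F) Y)"
    using f by (simp add: X Y karoubi_hom karoubi_map_obj map_hom)
next
  fix X assume "X \<in> Obj (karoubi C)"
  then show "on_arr (karoubi_ftor F) (Idt (karoubi C) X) = Idt (karoubi D) (on_obj (karoubi_ftor F) X)"
    by (cases X) auto
next
  fix \<phi> \<psi> X Y Z assume "\<phi> \<in> hom (karoubi C) X Y" "\<psi> \<in> hom (karoubi C) Y Z"
  then show "on_arr (karoubi_ftor F) (Comp (karoubi C) \<psi> \<phi>) =
      Comp (karoubi D) (on_arr (karoubi_ftor F) \<psi>) (on_arr (karoubi_ftor F) \<phi>)"
    by (cases X; cases Y; cases Z) (auto simp: karoubi_hom map_comp)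
qed

end

text \<open>An arrow of the envelope must absorb the idempotents of its source and target, which
  \<open>\<eta> x\<close> alone need not do. Precomposing it with \<open>e\<close> suffices on both
  sides, since naturality of \<open>\<eta>\<close> trades this \<open>e\<close> for
  \<open>FG e\<close> after the unit. The counit is corrected by \<open>e\<close> on its target side
  for the same reason.\<close>

lemma (in adjunction) karoubi_adjunction:
  "adjunction (karoubi C) (karoubi D) (karoubi_ftor F) (karoubi_ftor G)
    (\<lambda>(x, e). ((x, e), Comp D (\<eta> x) e, (on_obj F (on_obj G x), on_arr F (on_arr G e))))
    (\<lambda>(x, e). ((on_obj G (on_obj F x), on_arr G (on_arr F e)), Comp C e (\<epsilon> x), (x, e)))"
  (is "adjunction _ _ _ _ ?h ?e")
proof (intro adjunction.intro adjunction_axioms.intro)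
  show "cfunctor (karoubi C) (karoubi D) (karoubi_ftor F)"
    by (rule right.karoubi_cfunctor)
  show "cfunctor (karoubi D) (karoubi C) (karoubi_ftor G)"
    by (rule left.karoubi_cfunctor)
next
  fix X assume "X \<in> Obj (karoubi D)"
  moreover obtain x e where X: "X = (x, e)" by (cases X)
  ultimately have o: "(x, e) \<in> Obj (karoubi D)" by simp
  then have x: "x \<in> Obj D" "e \<in> hom D x x" "Comp D e e = e" by (auto simp: karoubi_obj)
  note h = unit_hom[OF x(1)] and FGe = right.map_hom[OF left.map_hom[OF x(2)]]
  have 1: "Comp D (\<eta> x) e \<in> hom D x (on_obj F (on_obj G x))"
    by (rule right.cod.comp_hom[OF x(2) h])
  have 2: "Comp D (Comp D (\<eta> x) e) e = Comp D (\<eta> x) e"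
    using right.cod.comp_assoc[OF x(2) x(2) h] x(3) by simp
  have 3: "Comp D (on_arr F (on_arr G e)) (Comp D (\<eta> x) e) = Comp D (\<eta> x) e"
    using right.cod.comp_assoc[OF x(2) h FGe] unit_nat[OF x(2)] 2 by simp
  show "?h X \<in> hom (karoubi D) X (on_obj (karoubi_ftor F) (on_obj (karoubi_ftor G) X))"
    using 1 2 3 o right.karoubi_map_obj[OF left.karoubi_map_obj[OF o]] by (simp add: X karoubi_hom)
  have Ge: "on_arr G e \<in> hom C (on_obj G x) (on_obj G x)" by (rule left.map_hom[OF x(2)])
  note Gh = left.map_hom[OF h] and el = counit_hom[OF left.map_obj[OF x(1)]]
  \<comment> \<open>The identity of the object \<open>(G x, G e)\<close> of the envelope is
    \<open>G e\<close>, so the triangle has to collapse to \<open>G e\<close>.\<close>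
  have "Comp C (Comp C (on_arr G e) (\<epsilon> (on_obj G x))) (on_arr G (Comp D (\<eta> x) e))
      = Comp C (on_arr G e) (Comp C (\<epsilon> (on_obj G x)) (Comp C (on_arr G (\<eta> x)) (on_arr G e)))"
    using left.map_comp[OF x(2) h]
      right.dom.comp_assoc[OF right.dom.comp_hom[OF Ge Gh] el Ge] by simp
  also have "\<dots> = Comp C (on_arr G e) (on_arr G e)"
    using right.dom.comp_assoc[OF Ge Gh el] triangle_left[OF x(1)] right.dom.idt_comp[OF Ge] by simp
  also have "\<dots> = on_arr G e" using left.map_comp[OF x(2) x(2)] x(3) by simp
  finally show "Comp (karoubi C) (?e (on_obj (karoubi_ftor G) X)) (on_arr (karoubi_ftor G) (?h X))
      = Idt (karoubi C) (on_obj (karoubi_ftor G) X)"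
    by (simp add: X)
next
  fix X assume "X \<in> Obj (karoubi C)"
  moreover obtain x e where X: "X = (x, e)" by (cases X)
  ultimately have o: "(x, e) \<in> Obj (karoubi C)" by simp
  then have x: "x \<in> Obj C" "e \<in> hom C x x" "Comp C e e = e" by (auto simp: karoubi_obj)
  note h = counit_hom[OF x(1)] and GFe = left.map_hom[OF right.map_hom[OF x(2)]]
  have 1: "Comp C e (\<epsilon> x) \<in> hom C (on_obj G (on_obj F x)) x"
    by (rule right.dom.comp_hom[OF h x(2)])
  have 2: "Comp C e (Comp C e (\<epsilon> x)) = Comp C e (\<epsilon> x)"
    using right.dom.comp_assoc[OF h x(2) x(2)] x(3) by simp
  have 3: "Comp C (Comp C e (\<epsilon> x)) (on_arr G (on_arr F e)) = Comp C e (\<epsilon> x)"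
    using right.dom.comp_assoc[OF GFe h x(2)] counit_nat[OF x(2)] 2 by simp
  show "?e X \<in> hom (karoubi C) (on_obj (karoubi_ftor G) (on_obj (karoubi_ftor F) X)) X"
    using 1 2 3 o left.karoubi_map_obj[OF right.karoubi_map_obj[OF o]] by (simp add: X karoubi_hom)
  have Fe: "on_arr F e \<in> hom D (on_obj F x) (on_obj F x)" by (rule right.map_hom[OF x(2)])
  note Fh = right.map_hom[OF h] and el = unit_hom[OF right.map_obj[OF x(1)]]
  have "Comp D (on_arr F (Comp C e (\<epsilon> x))) (Comp D (\<eta> (on_obj F x)) (on_arr F e))
      = Comp D (on_arr F e) (Comp D (Comp D (on_arr F (\<epsilon> x)) (\<eta> (on_obj F x))) (on_arr F e))"
    using right.map_comp[OF h x(2)] right.cod.comp_assoc[OF Fe el Fh]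
      right.cod.comp_assoc[OF right.cod.comp_hom[OF Fe el] Fh Fe] by simp
  also have "\<dots> = Comp D (on_arr F e) (on_arr F e)"
    using triangle_right[OF x(1)] right.cod.idt_comp[OF Fe] by simp
  also have "\<dots> = on_arr F e" using right.map_comp[OF x(2) x(2)] x(3) by simp
  finally show "Comp (karoubi D) (on_arr (karoubi_ftor F) (?e X)) (?h (on_obj (karoubi_ftor F) X))
      = Idt (karoubi D) (on_obj (karoubi_ftor F) X)"
    by (simp add: X)
next
  fix \<phi> X Y assume "\<phi> \<in> hom (karoubi D) X Y"
  moreover obtain x e where X: "X = (x, e)" by (cases X)
  moreover obtain y d where Y: "Y = (y, d)" by (cases Y)
  ultimately obtain f where f: "\<phi> = ((x, e), f, (y, d))" "x \<in> Obj D" "y \<in> Obj D"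
    "e \<in> hom D x x" "d \<in> hom D y y" "f \<in> hom D x y" "Comp D d f = f" "Comp D f e = f"
    by (auto simp: karoubi_hom karoubi_obj)
  have "Comp D (on_arr F (on_arr G f)) (Comp D (\<eta> x) e) = Comp D (Comp D (\<eta> y) f) e"
    using unit_nat[OF f(6)] 
      right.cod.comp_assoc[OF f(4) unit_hom[OF f(2)] right.map_hom[OF left.map_hom[OF f(6)]]] by simp
  also have "\<dots> = Comp D (\<eta> y) f"
    using right.cod.comp_assoc[OF f(4,6) unit_hom[OF f(3)]] f(8) by simp
  also have "\<dots> = Comp D (Comp D (\<eta> y) d) f"
    using right.cod.comp_assoc[OF f(6,5) unit_hom[OF f(3)]] f(7) by simp
  finally show "Comp (karoubi D) (?h Y) \<phi> =
      Comp (karoubi D) (on_arr (karoubi_ftor F) (on_arr (karoubi_ftor G) \<phi>)) (?h X)"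
    by (simp add: X Y f(1))
next
  fix \<phi> X Y assume "\<phi> \<in> hom (karoubi C) X Y"
  moreover obtain x e where X: "X = (x, e)" by (cases X)
  moreover obtain y d where Y: "Y = (y, d)" by (cases Y)
  ultimately obtain f where f: "\<phi> = ((x, e), f, (y, d))" "x \<in> Obj C" "y \<in> Obj C"
    "e \<in> hom C x x" "d \<in> hom C y y" "f \<in> hom C x y" "Comp C d f = f" "Comp C f e = f"
    by (auto simp: karoubi_hom karoubi_obj)
  have "Comp C (Comp C d (\<epsilon> y)) (on_arr G (on_arr F f)) = Comp C d (Comp C f (\<epsilon> x))"
    using counit_nat[OF f(6)] 
      right.dom.comp_assoc[OF left.map_hom[OF right.map_hom[OF f(6)]] counit_hom[OF f(3)] f(5)] by simp
  also have "\<dots> = Comp C f (\<epsilon> x)"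
    using right.dom.comp_assoc[OF counit_hom[OF f(2)] f(6,5)] f(7) by simp
  also have "\<dots> = Comp C f (Comp C e (\<epsilon> x))"
    using right.dom.comp_assoc[OF counit_hom[OF f(2)] f(4,6)] f(8) by simp
  finally show "Comp (karoubi C) (?e Y) (on_arr (karoubi_ftor G) (on_arr (karoubi_ftor F) \<phi>)) =
      Comp (karoubi C) \<phi> (?e X)"
    by (simp add: X Y f(1))
qed

section \<open>The additive completion\<close>

text \<open>Bilinearity is demanded of all elements of the monoid, not only of those in the hom
  sets, so that composition distributes over sums of matrix entries without side conditions.\<close>

locale linear_category =
  fixes L :: "('o, 'm::comm_monoid_add) lincat"
  assumes zero_hom: "x \<in> LObj L \<Longrightarrow> y \<in> LObj L \<Longrightarrow> 0 \<in> LHom L x y"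
    and add_hom: "f \<in> LHom L x y \<Longrightarrow> g \<in> LHom L x y \<Longrightarrow> f + g \<in> LHom L x y"
    and lidt_hom: "x \<in> LObj L \<Longrightarrow> LIdt L x \<in> LHom L x x"
    and lcomp_hom: "x \<in> LObj L \<Longrightarrow> y \<in> LObj L \<Longrightarrow> z \<in> LObj L \<Longrightarrow>
      f \<in> LHom L x y \<Longrightarrow> g \<in> LHom L y z \<Longrightarrow> LComp L x y z g f \<in> LHom L x z"
    and lcomp_zero_left: "LComp L x y z 0 f = 0"
    and lcomp_zero_right: "LComp L x y z g 0 = 0"
    and lcomp_add_left: "LComp L x y z (g + g') f = LComp L x y z g f + LComp L x y z g' f"
    and lcomp_add_right: "LComp L x y z g (f + f') = LComp L x y z g f + LComp L x y z g f'"
    and lcomp_lidt: "x \<in> LObj L \<Longrightarrow> y \<in> LObj L \<Longrightarrow> f \<in> LHom L x y \<Longrightarrow> LComp L x x y f (LIdt L x) = f"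
    and lidt_lcomp: "x \<in> LObj L \<Longrightarrow> y \<in> LObj L \<Longrightarrow> f \<in> LHom L x y \<Longrightarrow> LComp L x y y (LIdt L y) f = f"
    and lcomp_assoc: "w \<in> LObj L \<Longrightarrow> x \<in> LObj L \<Longrightarrow> y \<in> LObj L \<Longrightarrow> z \<in> LObj L \<Longrightarrow>
      f \<in> LHom L w x \<Longrightarrow> g \<in> LHom L x y \<Longrightarrow> h \<in> LHom L y z \<Longrightarrow>
      LComp L w y z h (LComp L w x y g f) = LComp L w x z (LComp L x y z h g) f"

definition is_matrix :: "('o, 'm::comm_monoid_add) lincat \<Rightarrow> 'o list \<Rightarrow> 'o list \<Rightarrow> (nat \<Rightarrow> nat \<Rightarrow> 'm) \<Rightarrow> bool" where
  "is_matrix L xs ys M \<longleftrightarrow> xs \<in> lists (LObj L) \<and> ys \<in> lists (LObj L) \<and>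
    (\<forall>i j. if i < length ys \<and> j < length xs then M i j \<in> LHom L (xs ! j) (ys ! i) else M i j = 0)"

definition matrix_comp :: "('o, 'm::comm_monoid_add) lincat \<Rightarrow> 'o list \<Rightarrow> 'o list \<Rightarrow> 'o list \<Rightarrow>
    (nat \<Rightarrow> nat \<Rightarrow> 'm) \<Rightarrow> (nat \<Rightarrow> nat \<Rightarrow> 'm) \<Rightarrow> nat \<Rightarrow> nat \<Rightarrow> 'm" where
  "matrix_comp L xs ys zs N M i j = (if i < length zs \<and> j < length xs
    then \<Sum>k<length ys. LComp L (xs ! j) (ys ! k) (zs ! i) (N i k) (M k j) else 0)"

definition diag :: "('o \<Rightarrow> 'm::zero) \<Rightarrow> 'o list \<Rightarrow> nat \<Rightarrow> nat \<Rightarrow> 'm" where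
  "diag d xs i j = (if i = j \<and> i < length xs then d (xs ! i) else 0)"

lemma add_completion_sel [simp]:
  "Obj (add_completion L) = lists (LObj L)"
  "Dom (add_completion L) (xs, M, ys) = xs" "Cod (add_completion L) (xs, M, ys) = ys"
  "Idt (add_completion L) xs = (xs, diag (LIdt L) xs, xs)"
  "Comp (add_completion L) (ys, N, zs) (xs, M, ys') = (xs, matrix_comp L xs ys zs N M, zs)"
  by (auto simp: add_completion_def diag_def matrix_comp_def fun_eq_iff)

lemma add_completion_hom: "\<phi> \<in> hom (add_completion L) xs ys \<longleftrightarrow> (\<exists>M. \<phi> = (xs, M, ys) \<and> is_matrix L xs ys M)"
  by (cases \<phi>) (auto simp: hom_def add_completion_def is_matrix_def)

lemma diag_map: "diag d (map s ns) = diag (\<lambda>x. d (s x)) ns"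
  by (auto simp: diag_def fun_eq_iff)

text \<open>The entry at \<open>x\<close> may lead from \<open>s x\<close> to a different object
  \<open>t x\<close>, because diagonal matrices serve here not only as identities but also as units
  and counits, whose source and target lists differ.\<close>

lemma is_matrix_diag:
  assumes "\<And>x. x \<in> set ns \<Longrightarrow> s x \<in> LObj L \<and> t x \<in> LObj L \<and> d x \<in> LHom L (s x) (t x)"
    and "\<And>x y. x \<in> LObj L \<Longrightarrow> y \<in> LObj L \<Longrightarrow> 0 \<in> LHom L x y"
  shows "is_matrix L (map s ns) (map t ns) (diag d ns)"
  using assms by (auto simp: is_matrix_def diag_def)

context linear_category begin

lemma sum_hom: "(\<And>k. k \<in> K \<Longrightarrow> f k \<in> LHom L x y) \<Longrightarrow> x \<in> LObj L \<Longrightarrow> y \<in> LObj L \<Longrightarrow> sum f K \<in> LHom L x y"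
  by (induction K rule: infinite_finite_induct) (auto simp: zero_hom add_hom)

lemma lcomp_sum_left: "LComp L x y z (sum g K) f = (\<Sum>k\<in>K. LComp L x y z (g k) f)"
  by (induction K rule: infinite_finite_induct) (auto simp: lcomp_zero_left lcomp_add_left)

lemma lcomp_sum_right: "LComp L x y z g (sum f K) = (\<Sum>k\<in>K. LComp L x y z g (f k))"
  by (induction K rule: infinite_finite_induct) (auto simp: lcomp_zero_right lcomp_add_right)

lemma is_matrix_comp:
  assumes "is_matrix L xs ys M" "is_matrix L ys zs N"
  shows "is_matrix L xs zs (matrix_comp L xs ys zs N M)"
  unfolding is_matrix_def
proof (intro conjI allI)
  show "xs \<in> lists (LObj L)" "zs \<in> lists (LObj L)" using assms by (auto simp: is_matrix_def)
  fix i j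
  have "LComp L (xs ! j) (ys ! k) (zs ! i) (N i k) (M k j) \<in> LHom L (xs ! j) (zs ! i)"
    if "i < length zs" "j < length xs" "k < length ys" for k
    using that assms by (intro lcomp_hom) (auto simp: is_matrix_def)
  then show "if i < length zs \<and> j < length xs then matrix_comp L xs ys zs N M i j \<in> LHom L (xs ! j) (zs ! i)
      else matrix_comp L xs ys zs N M i j = 0"
    using assms by (auto simp: matrix_comp_def is_matrix_def intro!: sum_hom)
qed

text \<open>Only the summand \<open>k = i\<close> survives, the others vanishing by
  \<open>lcomp_zero_left\<close>. A diagonal factor thus acts entrywise, which reduces naturality of
  a diagonal family to naturality of its entries.\<close>

lemma diag_matrix_comp:
  "matrix_comp L xs (map s ns) (map t ns) (diag d ns) M = (\<lambda>i j. if i < length ns \<and> j < length xs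
    then LComp L (xs ! j) (s (ns ! i)) (t (ns ! i)) (d (ns ! i)) (M i j) else 0)"
proof (intro ext)
  fix i j
  have "(\<Sum>k<length ns. LComp L (xs ! j) (map s ns ! k) (map t ns ! i) (diag d ns i k) (M k j)) =
      (\<Sum>k<length ns. if k = i then LComp L (xs ! j) (s (ns ! i)) (t (ns ! i)) (d (ns ! i)) (M i j) else 0)"
    if "i < length ns"
    using that by (intro sum.cong) (auto simp: diag_def lcomp_zero_left)
  then show "matrix_comp L xs (map s ns) (map t ns) (diag d ns) M i j = (if i < length ns \<and> j < length xs
    then LComp L (xs ! j) (s (ns ! i)) (t (ns ! i)) (d (ns ! i)) (M i j) else 0)"
    by (simp add: matrix_comp_def)
qed

lemma matrix_comp_diag:
  "matrix_comp L (map s ns) (map t ns) ys M (diag d ns) = (\<lambda>i j. if i < length ys \<and> j < length ns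
    then LComp L (s (ns ! j)) (t (ns ! j)) (ys ! i) (M i j) (d (ns ! j)) else 0)"
proof (intro ext)
  fix i j
  have "(\<Sum>k<length ns. LComp L (map s ns ! j) (map t ns ! k) (ys ! i) (M i k) (diag d ns k j)) =
      (\<Sum>k<length ns. if k = j then LComp L (s (ns ! j)) (t (ns ! j)) (ys ! i) (M i j) (d (ns ! j)) else 0)"
    if "j < length ns"
    using that by (intro sum.cong) (auto simp: diag_def lcomp_zero_right)
  then show "matrix_comp L (map s ns) (map t ns) ys M (diag d ns) i j = (if i < length ys \<and> j < length ns
    then LComp L (s (ns ! j)) (t (ns ! j)) (ys ! i) (M i j) (d (ns ! j)) else 0)"
    by (simp add: matrix_comp_def)
qed

lemma matrix_comp_assoc:
  assumes M: "is_matrix L ws xs M" and N: "is_matrix L xs ys N" and P: "is_matrix L ys zs P"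
  shows "matrix_comp L ws ys zs P (matrix_comp L ws xs ys N M) =
    matrix_comp L ws xs zs (matrix_comp L xs ys zs P N) M"
proof (intro ext)
  fix i j
  have "(\<Sum>k<length ys. LComp L (ws ! j) (ys ! k) (zs ! i) (P i k) (matrix_comp L ws xs ys N M k j)) =
      (\<Sum>l<length xs. LComp L (ws ! j) (xs ! l) (zs ! i) (matrix_comp L xs ys zs P N i l) (M l j))"
    if i: "i < length zs" and j: "j < length ws"
  proof -
    have "(\<Sum>k<length ys. LComp L (ws ! j) (ys ! k) (zs ! i) (P i k) (matrix_comp L ws xs ys N M k j)) =
       (\<Sum>k<length ys. \<Sum>l<length xs. LComp L (ws ! j) (ys ! k) (zs ! i) (P i k)
          (LComp L (ws ! j) (xs ! l) (ys ! k) (N k l) (M l j)))"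
      using j by (simp add: matrix_comp_def lcomp_sum_right)
    also have "\<dots> = (\<Sum>k<length ys. \<Sum>l<length xs. LComp L (ws ! j) (xs ! l) (zs ! i)
          (LComp L (xs ! l) (ys ! k) (zs ! i) (P i k) (N k l)) (M l j))"
      using i j M N P by (intro sum.cong refl lcomp_assoc) (auto simp: is_matrix_def)
    also have "\<dots> = (\<Sum>l<length xs. \<Sum>k<length ys. LComp L (ws ! j) (xs ! l) (zs ! i)
          (LComp L (xs ! l) (ys ! k) (zs ! i) (P i k) (N k l)) (M l j))"
      by (rule sum.swap)
    also have "\<dots> = (\<Sum>l<length xs. LComp L (ws ! j) (xs ! l) (zs ! i) (matrix_comp L xs ys zs P N i l) (M l j))"
      using i by (simp add: matrix_comp_def lcomp_sum_left)
    finally show ?thesis .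
  qed
  then show "matrix_comp L ws ys zs P (matrix_comp L ws xs ys N M) i j =
    matrix_comp L ws xs zs (matrix_comp L xs ys zs P N) M i j"
    unfolding matrix_comp_def[of L ws ys zs P] matrix_comp_def[of L ws xs zs _ M] by simp
qed

lemma add_completion_category: "category (add_completion L)"
proof
  fix \<phi> assume "\<phi> \<in> Arr (add_completion L)"
  then show "Dom (add_completion L) \<phi> \<in> Obj (add_completion L)" "Cod (add_completion L) \<phi> \<in> Obj (add_completion L)"
    by (auto simp: add_completion_def)
next
  fix xs assume "xs \<in> Obj (add_completion L)"
  then show "Idt (add_completion L) xs \<in> hom (add_completion L) xs xs"
    using is_matrix_diag[of xs "\<lambda>x. x" L "\<lambda>x. x" "LIdt L"]
    by (auto simp: add_completion_hom zero_hom lidt_hom)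
next
  fix \<phi> \<psi> X Y Z assume "\<phi> \<in> hom (add_completion L) X Y" "\<psi> \<in> hom (add_completion L) Y Z"
  then show "Comp (add_completion L) \<psi> \<phi> \<in> hom (add_completion L) X Z"
    by (auto simp: add_completion_hom is_matrix_comp)
next
  fix \<phi> X Y assume h: "\<phi> \<in> hom (add_completion L) X Y"
  then show "Comp (add_completion L) \<phi> (Idt (add_completion L) X) = \<phi>"
    using matrix_comp_diag[of "\<lambda>x. x" X "\<lambda>x. x"]
    by (auto simp: add_completion_hom fun_eq_iff is_matrix_def lcomp_lidt)
  show "Comp (add_completion L) (Idt (add_completion L) Y) \<phi> = \<phi>"
    using h diag_matrix_comp[of _ "\<lambda>x. x" Y "\<lambda>x. x"]
    by (auto simp: add_completion_hom fun_eq_iff is_matrix_def lidt_lcomp)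
next
  fix \<phi> \<psi> \<chi> W X Y Z
  assume "\<phi> \<in> hom (add_completion L) W X" "\<psi> \<in> hom (add_completion L) X Y" "\<chi> \<in> hom (add_completion L) Y Z"
  then show "Comp (add_completion L) \<chi> (Comp (add_completion L) \<psi> \<phi>) =
      Comp (add_completion L) (Comp (add_completion L) \<chi> \<psi>) \<phi>"
    by (auto simp: add_completion_hom matrix_comp_assoc)
qed

end

section \<open>Functors between additive completions\<close>

locale linear_functor = dom: linear_category L + cod: linear_category K
  for L :: "('o, 'm::comm_monoid_add) lincat" and K :: "('p, 'n::comm_monoid_add) lincat" +
  fixes fo :: "'o \<Rightarrow> 'p" and fm :: "'o \<Rightarrow> 'o \<Rightarrow> 'm \<Rightarrow> 'n"
  assumes lmap_obj: "x \<in> LObj L \<Longrightarrow> fo x \<in> LObj K"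
    and lmap_hom: "x \<in> LObj L \<Longrightarrow> y \<in> LObj L \<Longrightarrow> f \<in> LHom L x y \<Longrightarrow> fm x y f \<in> LHom K (fo x) (fo y)"
    and lmap_zero: "fm x y 0 = 0"
    and lmap_add: "fm x y (f + g) = fm x y f + fm x y g"
    and lmap_idt: "x \<in> LObj L \<Longrightarrow> fm x x (LIdt L x) = LIdt K (fo x)"
    and lmap_comp: "x \<in> LObj L \<Longrightarrow> y \<in> LObj L \<Longrightarrow> z \<in> LObj L \<Longrightarrow>
      f \<in> LHom L x y \<Longrightarrow> g \<in> LHom L y z \<Longrightarrow>
      fm x z (LComp L x y z g f) = LComp K (fo x) (fo y) (fo z) (fm y z g) (fm x y f)"

definition map_matrix :: "('o \<Rightarrow> 'o \<Rightarrow> 'm \<Rightarrow> 'n::comm_monoid_add) \<Rightarrow> 'o list \<Rightarrow> 'o list \<Rightarrow>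
    (nat \<Rightarrow> nat \<Rightarrow> 'm) \<Rightarrow> nat \<Rightarrow> nat \<Rightarrow> 'n" where
  "map_matrix fm xs ys M i j = (if i < length ys \<and> j < length xs then fm (xs ! j) (ys ! i) (M i j) else 0)"

lemma add_ftor_sel [simp]:
  "on_obj (add_ftor fo fm) = map fo"
  "on_arr (add_ftor fo fm) (xs, M, ys) = (map fo xs, map_matrix fm xs ys M, map fo ys)"
  by (auto simp: add_ftor_def map_matrix_def fun_eq_iff)

context linear_functor begin

lemma lmap_sum: "fm x y (sum f I) = (\<Sum>i\<in>I. fm x y (f i))"
  by (induction I rule: infinite_finite_induct) (auto simp: lmap_zero lmap_add)

lemma map_matrix_diag:
  "map_matrix fm (map s ns) (map t ns) (diag d ns) = diag (\<lambda>x. fm (s x) (t x) (d x)) ns"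
  by (auto simp: map_matrix_def diag_def fun_eq_iff lmap_zero)

lemma map_is_matrix: "is_matrix L xs ys M \<Longrightarrow> is_matrix K (map fo xs) (map fo ys) (map_matrix fm xs ys M)"
  by (auto simp: is_matrix_def map_matrix_def lmap_hom lmap_obj)

lemma map_matrix_comp:
  assumes M: "is_matrix L xs ys M" and N: "is_matrix L ys zs N"
  shows "map_matrix fm xs zs (matrix_comp L xs ys zs N M) =
    matrix_comp K (map fo xs) (map fo ys) (map fo zs) (map_matrix fm ys zs N) (map_matrix fm xs ys M)"
proof (intro ext)
  fix i j
  have "fm (xs ! j) (zs ! i) (LComp L (xs ! j) (ys ! k) (zs ! i) (N i k) (M k j)) =
    LComp K (fo (xs ! j)) (fo (ys ! k)) (fo (zs ! i)) (fm (ys ! k) (zs ! i) (N i k)) (fm (xs ! j) (ys ! k) (M k j))"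
    if "i < length zs" "j < length xs" "k < length ys" for k
    using that M N by (intro lmap_comp) (auto simp: is_matrix_def)
  then show "map_matrix fm xs zs (matrix_comp L xs ys zs N M) i j =
    matrix_comp K (map fo xs) (map fo ys) (map fo zs) (map_matrix fm ys zs N) (map_matrix fm xs ys M) i j"
    by (auto simp: map_matrix_def matrix_comp_def lmap_sum intro!: sum.cong)
qed

lemma add_cfunctor: "cfunctor (add_completion L) (add_completion K) (add_ftor fo fm)"
proof (intro cfunctor.intro cfunctor_axioms.intro)
  show "category (add_completion L)" "category (add_completion K)"
    using dom.add_completion_category cod.add_completion_category by auto
next
  fix xs assume xs: "xs \<in> Obj (add_completion L)"
  then show "on_obj (add_ftor fo fm) xs \<in> Obj (add_completion K)" by (auto simp: lmap_obj)
  have "diag (\<lambda>x. fm x x (LIdt L x)) xs = diag (LIdt K) (map fo xs)"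
    using xs by (auto simp: diag_def fun_eq_iff in_lists_conv_set lmap_idt)
  then show "on_arr (add_ftor fo fm) (Idt (add_completion L) xs) =
      Idt (add_completion K) (on_obj (add_ftor fo fm) xs)"
    using map_matrix_diag[of "\<lambda>x. x" xs "\<lambda>x. x" "LIdt L"] by simp
next
  fix \<phi> xs ys assume "\<phi> \<in> hom (add_completion L) xs ys"
  then show "on_arr (add_ftor fo fm) \<phi> \<in> hom (add_completion K) (on_obj (add_ftor fo fm) xs) (on_obj (add_ftor fo fm) ys)"
    by (auto simp: add_completion_hom map_is_matrix)
next
  fix \<phi> \<psi> X Y Z assume "\<phi> \<in> hom (add_completion L) X Y" "\<psi> \<in> hom (add_completion L) Y Z"
  then show "on_arr (add_ftor fo fm) (Comp (add_completion L) \<psi> \<phi>) =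
      Comp (add_completion K) (on_arr (add_ftor fo fm) \<psi>) (on_arr (add_ftor fo fm) \<phi>)"
    by (auto simp: add_completion_hom map_matrix_comp)
qed

end

section \<open>Adjunctions between additive completions\<close>

locale linear_adjunction = right: linear_functor L K fo fm + left: linear_functor K L go gm
  for L :: "('o, 'm::comm_monoid_add) lincat" and K :: "('p, 'n::comm_monoid_add) lincat"
    and fo :: "'o \<Rightarrow> 'p" and fm :: "'o \<Rightarrow> 'o \<Rightarrow> 'm \<Rightarrow> 'n"
    and go :: "'p \<Rightarrow> 'o" and gm :: "'p \<Rightarrow> 'p \<Rightarrow> 'n \<Rightarrow> 'm" +
  fixes \<eta> :: "'p \<Rightarrow> 'n" and \<epsilon> :: "'o \<Rightarrow> 'm"
  assumes lunit_hom: "x' \<in> LObj K \<Longrightarrow> \<eta> x' \<in> LHom K x' (fo (go x'))"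
    and lunit_nat: "x' \<in> LObj K \<Longrightarrow> y' \<in> LObj K \<Longrightarrow> f' \<in> LHom K x' y' \<Longrightarrow>
      LComp K x' y' (fo (go y')) (\<eta> y') f' =
      LComp K x' (fo (go x')) (fo (go y')) (fm (go x') (go y') (gm x' y' f')) (\<eta> x')"
    and lcounit_hom: "x \<in> LObj L \<Longrightarrow> \<epsilon> x \<in> LHom L (go (fo x)) x"
    and lcounit_nat: "x \<in> LObj L \<Longrightarrow> y \<in> LObj L \<Longrightarrow> f \<in> LHom L x y \<Longrightarrow>
      LComp L (go (fo x)) (go (fo y)) y (\<epsilon> y) (gm (fo x) (fo y) (fm x y f)) =
      LComp L (go (fo x)) x y f (\<epsilon> x)"
    and ltriangle_left: "x' \<in> LObj K \<Longrightarrow>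
      LComp L (go x') (go (fo (go x'))) (go x') (\<epsilon> (go x')) (gm x' (fo (go x')) (\<eta> x')) = LIdt L (go x')"
    and ltriangle_right: "x \<in> LObj L \<Longrightarrow>
      LComp K (fo x) (fo (go (fo x))) (fo x) (fm (go (fo x)) x (\<epsilon> x)) (\<eta> (fo x)) = LIdt K (fo x)"

lemma (in linear_adjunction) add_adjunction:
  "adjunction (add_completion L) (add_completion K) (add_ftor fo fm) (add_ftor go gm)
    (\<lambda>xs. (xs, diag \<eta> xs, map fo (map go xs))) (\<lambda>xs. (map go (map fo xs), diag \<epsilon> xs, xs))"
  (is "adjunction ?L ?K ?F ?G ?h ?e")
proof (intro adjunction.intro adjunction_axioms.intro)
  show "cfunctor ?L ?K ?F" by (rule right.add_cfunctor)
  show "cfunctor ?K ?L ?G" by (rule left.add_cfunctor)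
next
  fix xs assume xs: "xs \<in> Obj ?K"
  then show "?h xs \<in> hom ?K xs (on_obj ?F (on_obj ?G xs))"
    using is_matrix_diag[of xs "\<lambda>x. x" K "\<lambda>x. fo (go x)" \<eta>]
    by (auto simp: add_completion_hom comp_def in_lists_conv_set lunit_hom right.lmap_obj left.lmap_obj
        right.cod.zero_hom)
  have "matrix_comp L (map go xs) (map (\<lambda>x. go (fo (go x))) xs) (map go xs) (diag (\<lambda>x. \<epsilon> (go x)) xs)
      (diag (\<lambda>x. gm x (fo (go x)) (\<eta> x)) xs) = diag (\<lambda>x. LIdt L (go x)) xs"
    unfolding right.dom.diag_matrix_comp
    using xs by (auto simp: diag_def fun_eq_iff in_lists_conv_set ltriangle_left right.dom.lcomp_zero_right)
  then show "Comp ?L (?e (on_obj ?G xs)) (on_arr ?G (?h xs)) = Idt ?L (on_obj ?G xs)"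
    using left.map_matrix_diag[of "\<lambda>x. x" xs "\<lambda>x. fo (go x)" \<eta>]
    by (simp add: comp_def diag_map)
next
  fix xs assume xs: "xs \<in> Obj ?L"
  then show "?e xs \<in> hom ?L (on_obj ?G (on_obj ?F xs)) xs"
    using is_matrix_diag[of xs "\<lambda>x. go (fo x)" L "\<lambda>x. x" \<epsilon>]
    by (auto simp: add_completion_hom comp_def in_lists_conv_set lcounit_hom right.lmap_obj left.lmap_obj
        right.dom.zero_hom)
  have "matrix_comp K (map fo xs) (map (\<lambda>x. fo (go (fo x))) xs) (map fo xs) 
      (diag (\<lambda>x. fm (go (fo x)) x (\<epsilon> x)) xs) (diag (\<lambda>x. \<eta> (fo x)) xs) = diag (\<lambda>x. LIdt K (fo x)) xs"
    unfolding right.cod.diag_matrix_comp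
    using xs by (auto simp: diag_def fun_eq_iff in_lists_conv_set ltriangle_right right.cod.lcomp_zero_right)
  then show "Comp ?K (on_arr ?F (?e xs)) (?h (on_obj ?F xs)) = Idt ?K (on_obj ?F xs)"
    using right.map_matrix_diag[of "\<lambda>x. go (fo x)" xs "\<lambda>x. x" \<epsilon>]
    by (simp add: comp_def diag_map)
next
  fix \<phi> xs ys assume "\<phi> \<in> hom ?K xs ys"
  then obtain M where M: "\<phi> = (xs, M, ys)" "is_matrix K xs ys M" by (auto simp: add_completion_hom)
  then show "Comp ?K (?h ys) \<phi> = Comp ?K (on_arr ?F (on_arr ?G \<phi>)) (?h xs)"
    using right.cod.diag_matrix_comp[of xs "\<lambda>x. x" ys "\<lambda>x. fo (go x)" \<eta> M]
      right.cod.matrix_comp_diag[of "\<lambda>x. x" xs "\<lambda>x. fo (go x)"]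
    by (auto simp: comp_def fun_eq_iff is_matrix_def map_matrix_def lunit_nat)
next
  fix \<phi> xs ys assume "\<phi> \<in> hom ?L xs ys"
  then obtain M where M: "\<phi> = (xs, M, ys)" "is_matrix L xs ys M" by (auto simp: add_completion_hom)
  then show "Comp ?L (?e ys) (on_arr ?G (on_arr ?F \<phi>)) = Comp ?L \<phi> (?e xs)"
    using right.dom.diag_matrix_comp[of _ "\<lambda>x. go (fo x)" ys "\<lambda>x. x" \<epsilon>]
      right.dom.matrix_comp_diag[of "\<lambda>x. go (fo x)" xs "\<lambda>x. x" ys M \<epsilon>]
    by (auto simp: comp_def fun_eq_iff is_matrix_def map_matrix_def lcounit_nat)
qed

section \<open>Pullbacks, monomorphisms and products\<close>

context category begin

lemma comm_squareI:
  assumes "f \<in> hom C x z" "g \<in> hom C y z" "p \<in> hom C w x" "q \<in> hom C w y" "Comp C f p = Comp C g q"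
  shows "comm_square C f g p q"
  using assms by (auto simp: comm_square_def hom_def)

lemma comm_squareE:
  assumes "comm_square C f g p q"
  obtains w x y z where "f \<in> hom C x z" "g \<in> hom C y z" "p \<in> hom C w x" "q \<in> hom C w y"
    "Comp C f p = Comp C g q"
  using assms by (auto simp: comm_square_def hom_def)

lemma comm_squareD:
  assumes "comm_square C f g p q" "f \<in> hom C x z" "g \<in> hom C y z"
  shows "p \<in> hom C (Dom C p) x" "q \<in> hom C (Dom C p) y" "Comp C f p = Comp C g q"
  using assms by (auto simp: comm_square_def hom_def)

lemma is_pullbackI:
  assumes "f \<in> hom C x z" "g \<in> hom C y z" "p \<in> hom C w x" "q \<in> hom C w y" "Comp C f p = Comp C g q"
    and ex: "\<And>v p' q'. p' \<in> hom C v x \<Longrightarrow> q' \<in> hom C v y \<Longrightarrow> Comp C f p' = Comp C g q' \<Longrightarrow>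
      \<exists>u \<in> hom C v w. Comp C p u = p' \<and> Comp C q u = q'"
    and uniq: "\<And>v u u'. u \<in> hom C v w \<Longrightarrow> u' \<in> hom C v w \<Longrightarrow> Comp C p u = Comp C p u' \<Longrightarrow>
      Comp C q u = Comp C q u' \<Longrightarrow> u = u'"
  shows "is_pullback C f g p q"
  unfolding is_pullback_def
proof (intro conjI allI impI)
  show "comm_square C f g p q" using assms(1-5) by (rule comm_squareI)
  fix p' q' assume "comm_square C f g p' q'"
  then obtain v where v: "p' \<in> hom C v x" "q' \<in> hom C v y" "Comp C f p' = Comp C g q'"
    using comm_squareD[OF _ assms(1,2)] by blast
  then obtain u where "u \<in> hom C v w" "Comp C p u = p'" "Comp C q u = q'" using ex by blast
  then show "\<exists>!u. u \<in> hom C (Dom C p') (Dom C p) \<and> Comp C p u = p' \<and> Comp C q u = q'"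
    unfolding homD(2)[OF v(1)] homD(2)[OF assms(3)]
    using uniq[of _ v u] by metis
qed

lemma is_pullbackE:
  assumes "is_pullback C f g p q" "f \<in> hom C x z" "g \<in> hom C y z"
  obtains w where "p \<in> hom C w x" "q \<in> hom C w y" "Comp C f p = Comp C g q"
    "\<And>v p' q'. p' \<in> hom C v x \<Longrightarrow> q' \<in> hom C v y \<Longrightarrow> Comp C f p' = Comp C g q' \<Longrightarrow>
      \<exists>u \<in> hom C v w. Comp C p u = p' \<and> Comp C q u = q'"
    "\<And>v u u'. u \<in> hom C v w \<Longrightarrow> u' \<in> hom C v w \<Longrightarrow> Comp C p u = Comp C p u' \<Longrightarrow>
      Comp C q u = Comp C q u' \<Longrightarrow> u = u'"
proof -
  have sq: "comm_square C f g p q" using assms(1) by (simp add: is_pullback_def)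
  then obtain w where w: "p \<in> hom C w x" "q \<in> hom C w y" "Comp C f p = Comp C g q"
    using comm_squareD[OF _ assms(2,3)] by blast
  have univ: "\<exists>!u. u \<in> hom C v w \<and> Comp C p u = p' \<and> Comp C q u = q'"
    if "p' \<in> hom C v x" "q' \<in> hom C v y" "Comp C f p' = Comp C g q'" for v p' q'
  proof -
    have "\<exists>!u. u \<in> hom C (Dom C p') (Dom C p) \<and> Comp C p u = p' \<and> Comp C q u = q'"
      using assms(1) comm_squareI[OF assms(2,3) that] by (simp add: is_pullback_def)
    then show ?thesis by (simp only: homD(2)[OF that(1)] homD(2)[OF w(1)])
  qed
  show ?thesis
  proof (rule that[OF w])
    show "\<exists>u \<in> hom C v w. Comp C p u = p' \<and> Comp C q u = q'"
      if "p' \<in> hom C v x" "q' \<in> hom C v y" "Comp C f p' = Comp C g q'" for v p' q'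
      using univ[OF that] by blast
    fix v u u' assume u: "u \<in> hom C v w" "u' \<in> hom C v w" "Comp C p u = Comp C p u'" "Comp C q u = Comp C q u'"
    \<comment> \<open>The pair \<open>p u\<close>, \<open>q u\<close> is itself a commutative
      completion of the cospan, and both \<open>u\<close> and \<open>u'\<close> mediate it.\<close>
    have "Comp C f (Comp C p u) = Comp C g (Comp C q u)"
      using u(1) w assms(2,3) by (simp add: comp_assoc)
    then show "u = u'"
      using univ[OF comp_hom[OF u(1) w(1)] comp_hom[OF u(1) w(2)]] u by auto
  qed
qed

context
  fixes f g p q w x y z
  assumes pb: "is_pullback C f g p q" "f \<in> hom C x z" "g \<in> hom C y z" and p: "p \<in> hom C w x"
begin

lemma is_pullback_square: "q \<in> hom C w y" "Comp C f p = Comp C g q"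
  using comm_squareD[OF _ pb(2,3)] pb(1) homD(2)[OF p] by (auto simp: is_pullback_def)

lemma is_pullback_univ:
  assumes "p' \<in> hom C v x" "q' \<in> hom C v y" "Comp C f p' = Comp C g q'"
  shows "\<exists>u \<in> hom C v w. Comp C p u = p' \<and> Comp C q u = q'"
proof (rule is_pullbackE[OF pb])
  fix w' assume w': "p \<in> hom C w' x" and
    *: "\<And>v p' q'. p' \<in> hom C v x \<Longrightarrow> q' \<in> hom C v y \<Longrightarrow> Comp C f p' = Comp C g q' \<Longrightarrow>
      \<exists>u \<in> hom C v w'. Comp C p u = p' \<and> Comp C q u = q'"
  have "w' = w" using w' p by (simp add: hom_def)
  then show ?thesis using *[OF assms] by simp
qed

lemma is_pullback_uniq:
  assumes "u \<in> hom C v w" "u' \<in> hom C v w" "Comp C p u = Comp C p u'" "Comp C q u = Comp C q u'"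
  shows "u = u'"
proof (rule is_pullbackE[OF pb])
  fix w' assume w': "p \<in> hom C w' x" and
    *: "\<And>v u u'. u \<in> hom C v w' \<Longrightarrow> u' \<in> hom C v w' \<Longrightarrow> Comp C p u = Comp C p u' \<Longrightarrow>
      Comp C q u = Comp C q u' \<Longrightarrow> u = u'"
  have "w' = w" using w' p by (simp add: hom_def)
  then show ?thesis using * assms by blast
qed

end

lemma is_pullback_homE:
  assumes "is_pullback C f g p q"
  obtains w x y z where "f \<in> hom C x z" "g \<in> hom C y z" "p \<in> hom C w x" "q \<in> hom C w y"
    "Comp C f p = Comp C g q"
proof -
  have "comm_square C f g p q" using assms by (simp add: is_pullback_def)
  then show ?thesis by (rule comm_squareE) (rule that)
qed

lemma is_pullback_dom: "is_pullback C f g p q \<Longrightarrow> f \<in> hom C x z \<Longrightarrow> p \<in> hom C (Dom C p) x"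
  by (auto simp: is_pullback_def comm_square_def hom_def)

lemma is_pullback_sym:
  assumes "is_pullback C f g p q" shows "is_pullback C g f q p"
proof -
  obtain x y z where fg: "f \<in> hom C x z" "g \<in> hom C y z" using assms by (rule is_pullback_homE)
  note pb = assms fg
  obtain w where w: "p \<in> hom C w x" using is_pullback_dom[OF pb(1,2)] by blast
  note q = is_pullback_square[OF pb w]
  show ?thesis
  proof (rule is_pullbackI[OF fg(2,1) q(1) w q(2)[symmetric]])
    show "\<exists>u \<in> hom C v w. Comp C q u = q' \<and> Comp C p u = p'"
      if "q' \<in> hom C v y" "p' \<in> hom C v x" "Comp C g q' = Comp C f p'" for v p' q'
      using is_pullback_univ[OF pb w that(2,1) that(3)[symmetric]] by blast
    show "u = u'" if "u \<in> hom C v w" "u' \<in> hom C v w" "Comp C q u = Comp C q u'" "Comp C p u = Comp C p u'"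
      for v u u' using is_pullback_uniq[OF pb w that(1,2,4,3)] .
  qed
qed

lemma is_pullback_paste:
  assumes 1: "is_pullback C f g p q" and 2: "is_pullback C q h p' q'"
  shows "is_pullback C f (Comp C g h) (Comp C p p') q'"
proof -
  obtain x y z where fg: "f \<in> hom C x z" "g \<in> hom C y z" using 1 by (rule is_pullback_homE)
  obtain w where p: "p \<in> hom C w x" using is_pullback_dom[OF 1 fg(1)] by blast
  note w = p is_pullback_square[OF 1 fg p]
    and ex = is_pullback_univ[OF 1 fg p] and uniq = is_pullback_uniq[OF 1 fg p]
  obtain a where h: "h \<in> hom C a y"
    using 2 homD(3)[OF w(2)] by (auto simp: is_pullback_def comm_square_def hom_def)
  obtain b where p': "p' \<in> hom C b w" using is_pullback_dom[OF 2 w(2)] by blast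
  note b = p' is_pullback_square[OF 2 w(2) h p']
    and ex' = is_pullback_univ[OF 2 w(2) h p'] and uniq' = is_pullback_uniq[OF 2 w(2) h p']
  show ?thesis
  proof (rule is_pullbackI[OF fg(1) comp_hom[OF h fg(2)] comp_hom[OF b(1) w(1)] b(2)])
    show "Comp C f (Comp C p p') = Comp C (Comp C g h) q'"
      using comp_assoc[OF b(1) w(1) fg(1)] comp_assoc[OF b(1) w(2) fg(2)] comp_assoc[OF b(2) h fg(2)] w(3) b(3)
      by simp
  next
    fix v s t assume st: "s \<in> hom C v x" "t \<in> hom C v a" "Comp C f s = Comp C (Comp C g h) t"
    then obtain u where u: "u \<in> hom C v w" "Comp C p u = s" "Comp C q u = Comp C h t"
      using ex[of s v "Comp C h t"] comp_hom[OF st(2) h] comp_assoc[OF st(2) h fg(2)] by auto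
    then obtain u' where "u' \<in> hom C v b" "Comp C p' u' = u" "Comp C q' u' = t"
      using ex'[OF u(1) st(2)] by blast
    then show "\<exists>u\<in>hom C v b. Comp C (Comp C p p') u = s \<and> Comp C q' u = t"
      using u comp_assoc[OF _ b(1) w(1)] by metis
  next
    fix v u u' assume u: "u \<in> hom C v b" "u' \<in> hom C v b"
      "Comp C (Comp C p p') u = Comp C (Comp C p p') u'" "Comp C q' u = Comp C q' u'"
    have "Comp C q (Comp C p' u) = Comp C q (Comp C p' u')"
      using comp_assoc[OF u(1) b(1) w(2)] comp_assoc[OF u(2) b(1) w(2)] b(3) 
        comp_assoc[OF u(1) b(2) h] comp_assoc[OF u(2) b(2) h] u(4) by simp
    then have "Comp C p' u = Comp C p' u'"
      using uniq[OF comp_hom[OF u(1) b(1)] comp_hom[OF u(2) b(1)]] u(3)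
        comp_assoc[OF u(1) b(1) w(1)] comp_assoc[OF u(2) b(1) w(1)] by simp
    then show "u = u'" using uniq'[OF u(1,2)] u(4) by simp
  qed
qed

text \<open>The cancellation half of the pasting lemma. Associativity of span composition needs it
  to recognise an induced square as a pullback.\<close>

lemma is_pullback_cancel:
  assumes 1: "is_pullback C f g p q" and 2: "is_pullback C f (Comp C g h) r q'"
    and h: "h \<in> hom C a y" and g: "g \<in> hom C y z"
    and u: "u \<in> hom C b w" and p: "p \<in> hom C w x" and pu: "Comp C p u = r" and qu: "Comp C q u = Comp C h q'"
  shows "is_pullback C q h u q'"
proof -
  have f: "f \<in> hom C x z"
    using 1 homD(3)[OF g] homD(3)[OF p] by (auto simp: is_pullback_def comm_square_def hom_def)
  note q = is_pullback_square(1)[OF 1 f g p] and c = is_pullback_square(2)[OF 1 f g p]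
    and uniq = is_pullback_uniq[OF 1 f g p]
  have r: "r \<in> hom C b x" using comp_hom[OF u p] pu by simp
  note gh = comp_hom[OF h g]
  note q'h = is_pullback_square[OF 2 f gh r] and ex2 = is_pullback_univ[OF 2 f gh r]
    and uniq2 = is_pullback_uniq[OF 2 f gh r]
  show ?thesis
  proof (rule is_pullbackI[OF q h u q'h(1) qu])
    fix v s t assume st: "s \<in> hom C v w" "t \<in> hom C v a" "Comp C q s = Comp C h t"
    have "Comp C f (Comp C p s) = Comp C (Comp C g h) t"
      using comp_assoc[OF st(1) p f] c comp_assoc[OF st(1) q g] st(3) comp_assoc[OF st(2) h g] by simp
    then obtain k where k: "k \<in> hom C v b" "Comp C r k = Comp C p s" "Comp C q' k = t"
      using ex2[OF comp_hom[OF st(1) p] st(2)] by blast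
    have "Comp C u k = s"
    proof (rule uniq[OF comp_hom[OF k(1) u] st(1)])
      show "Comp C p (Comp C u k) = Comp C p s" using comp_assoc[OF k(1) u p] pu k(2) by simp
      show "Comp C q (Comp C u k) = Comp C q s"
        using comp_assoc[OF k(1) u q] qu comp_assoc[OF k(1) q'h(1) h] k(3) st(3) by simp
    qed
    then show "\<exists>k\<in>hom C v b. Comp C u k = s \<and> Comp C q' k = t" using k by blast
  next
    fix v k k' assume k: "k \<in> hom C v b" "k' \<in> hom C v b" "Comp C u k = Comp C u k'" "Comp C q' k = Comp C q' k'"
    then show "k = k'"
      using uniq2[OF k(1,2)] comp_assoc[OF k(1) u p] comp_assoc[OF k(2) u p] pu by simp
  qed
qed

section \<open>Isomorphisms and the comparison of pullbacks\<close>

lemma is_isoI: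
  assumes "f \<in> hom C x y" "g \<in> hom C y x" "Comp C g f = Idt C x" "Comp C f g = Idt C y"
  shows "is_iso C f"
  using assms by (auto simp: is_iso_def hom_def)

lemma is_isoE:
  assumes "is_iso C f" "f \<in> hom C x y"
  obtains g where "g \<in> hom C y x" "Comp C g f = Idt C x" "Comp C f g = Idt C y" "is_iso C g"
proof -
  obtain g where g: "g \<in> hom C y x" "Comp C g f = Idt C x" "Comp C f g = Idt C y"
    using assms by (auto simp: is_iso_def hom_def)
  then show ?thesis using that is_isoI[OF g(1) assms(2) g(3,2)] by blast
qed

lemma is_pullback_iso:
  assumes 1: "is_pullback C f g p q" and 2: "is_pullback C f g p' q'"
    and p: "p \<in> hom C w x" and p': "p' \<in> hom C w' x"
  obtains i where "i \<in> hom C w' w" "is_iso C i" "Comp C p i = p'" "Comp C q i = q'"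
proof -
  have fg: "f \<in> hom C x (Cod C f)" "g \<in> hom C (Dom C g) (Cod C f)"
    using 1 homD(3)[OF p] by (auto simp: is_pullback_def comm_square_def hom_def)
  note q = is_pullback_square[OF 1 fg p] and q' = is_pullback_square[OF 2 fg p']
  note u1 = is_pullback_uniq[OF 1 fg p] and u2 = is_pullback_uniq[OF 2 fg p']
  obtain i where i: "i \<in> hom C w' w" "Comp C p i = p'" "Comp C q i = q'"
    using is_pullback_univ[OF 1 fg p p' q'] by blast
  obtain j where j: "j \<in> hom C w w'" "Comp C p' j = p" "Comp C q' j = q"
    using is_pullback_univ[OF 2 fg p' p q] by blast
  have "Comp C i j = Idt C w"
  proof (rule u1[OF comp_hom[OF j(1) i(1)] idt_hom[OF hom_obj(1)[OF p]]])
    show "Comp C p (Comp C i j) = Comp C p (Idt C w)"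
      using comp_assoc[OF j(1) i(1) p] i(2) j(2) comp_idt[OF p] by simp
    show "Comp C q (Comp C i j) = Comp C q (Idt C w)"
      using comp_assoc[OF j(1) i(1) q(1)] i(3) j(3) comp_idt[OF q(1)] by simp
  qed
  moreover have "Comp C j i = Idt C w'"
  proof (rule u2[OF comp_hom[OF i(1) j(1)] idt_hom[OF hom_obj(1)[OF p']]])
    show "Comp C p' (Comp C j i) = Comp C p' (Idt C w')"
      using comp_assoc[OF i(1) j(1) p'] i(2) j(2) comp_idt[OF p'] by simp
    show "Comp C q' (Comp C j i) = Comp C q' (Idt C w')"
      using comp_assoc[OF i(1) j(1) q'(1)] i(3) j(3) comp_idt[OF q'(1)] by simp
  qed
  ultimately have "is_iso C i" using is_isoI[OF i(1) j(1)] by simp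
  then show ?thesis using that[OF i(1) _ i(2,3)] by simp
qed

lemma is_pullback_idt:
  assumes "g \<in> hom C y z" shows "is_pullback C g (Idt C z) (Idt C y) g"
proof -
  have y: "Idt C y \<in> hom C y y" and z: "Idt C z \<in> hom C z z" using hom_obj[OF assms] idt_hom by auto
  show ?thesis
  proof (rule is_pullbackI[OF assms z y assms])
    show "Comp C g (Idt C y) = Comp C (Idt C z) g" using assms by (simp add: comp_idt idt_comp)
    fix v p q assume v: "p \<in> hom C v y" "q \<in> hom C v z" "Comp C g p = Comp C (Idt C z) q"
    then show "\<exists>u\<in>hom C v y. Comp C (Idt C y) u = p \<and> Comp C g u = q"
      using idt_comp[OF v(1)] idt_comp[OF v(2)] by auto
  next
    fix v u u' assume u: "u \<in> hom C v y" "u' \<in> hom C v y" "Comp C (Idt C y) u = Comp C (Idt C y) u'"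
    then show "u = u'" using idt_comp[OF u(1)] idt_comp[OF u(2)] by simp
  qed
qed

text \<open>This makes every isomorphism a pullback of an identity, from which its degree can be
  read off as one.\<close>

lemma is_pullback_iso_idt:
  assumes "is_iso C i" "i \<in> hom C x y" shows "is_pullback C (Idt C y) (Idt C y) i i"
proof -
  obtain j where j: "j \<in> hom C y x" "Comp C j i = Idt C x" "Comp C i j = Idt C y"
    using assms by (rule is_isoE)
  have y: "Idt C y \<in> hom C y y" using hom_obj[OF assms(2)] by (simp add: idt_hom)
  show ?thesis
  proof (rule is_pullbackI[OF y y assms(2) assms(2) refl])
    fix v p q assume v: "p \<in> hom C v y" "q \<in> hom C v y" "Comp C (Idt C y) p = Comp C (Idt C y) q"
    then show "\<exists>u\<in>hom C v x. Comp C i u = p \<and> Comp C i u = q"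
      using comp_hom[OF v(1) j(1)] comp_assoc[OF v(1) j(1) assms(2)] j(3) idt_comp by metis
  next
    fix v u u' assume u: "u \<in> hom C v x" "u' \<in> hom C v x" "Comp C i u = Comp C i u'"
    then show "u = u'"
      using comp_assoc[OF u(1) assms(2) j(1)] comp_assoc[OF u(2) assms(2) j(1)] j(2) idt_comp by metis
  qed
qed

section \<open>Monomorphisms and epimorphisms\<close>

lemma monicI:
  assumes "m \<in> hom C x y"
    and "\<And>v g h. g \<in> hom C v x \<Longrightarrow> h \<in> hom C v x \<Longrightarrow> Comp C m g = Comp C m h \<Longrightarrow> g = h"
  shows "monic C m"
  unfolding monic_def homD(2)[OF assms(1)] using homD(1)[OF assms(1)] assms(2) by metis

lemma monicD:
  assumes "monic C m" "m \<in> hom C x y" "g \<in> hom C v x" "h \<in> hom C v x" "Comp C m g = Comp C m h"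
  shows "g = h"
  using assms by (auto simp: monic_def hom_def)

lemma epicI:
  assumes "e \<in> hom C x y"
    and "\<And>v g h. g \<in> hom C y v \<Longrightarrow> h \<in> hom C y v \<Longrightarrow> Comp C g e = Comp C h e \<Longrightarrow> g = h"
  shows "epic C e"
  unfolding epic_def homD(3)[OF assms(1)] using homD(1)[OF assms(1)] assms(2) by metis

lemma epicD:
  assumes "epic C e" "e \<in> hom C x y" "g \<in> hom C y v" "h \<in> hom C y v" "Comp C g e = Comp C h e"
  shows "g = h"
  using assms by (auto simp: epic_def hom_def)

lemma epic_comp:
  assumes m: "epic C m" "m \<in> hom C x y" and n: "epic C n" "n \<in> hom C y z"
  shows "epic C (Comp C n m)"
proof (rule epicI[OF comp_hom[OF m(2) n(2)]])
  fix v g h assume g: "g \<in> hom C z v" and h: "h \<in> hom C z v" and eq: "Comp C g (Comp C n m) = Comp C h (Comp C n m)"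
  have "Comp C g n = Comp C h n"
    by (rule epicD[OF m comp_hom[OF n(2) g] comp_hom[OF n(2) h]])
      (use eq comp_assoc[OF m(2) n(2) g] comp_assoc[OF m(2) n(2) h] in simp)
  then show "g = h" by (rule epicD[OF n g h])
qed

lemma iso_epic: assumes "is_iso C i" "i \<in> hom C x y" shows "epic C i"
proof (rule epicI[OF assms(2)])
  obtain j where j: "j \<in> hom C y x" "Comp C i j = Idt C y" using assms by (rule is_isoE)
  fix v g h assume "g \<in> hom C y v" "h \<in> hom C y v" "Comp C g i = Comp C h i"
  then show "g = h" using comp_assoc[OF j(1) assms(2)] j(2) comp_idt by metis
qed

lemma iso_idt: "x \<in> Obj C \<Longrightarrow> is_iso C (Idt C x)"
  by (rule is_isoI[of _ x x "Idt C x"]) (auto simp: idt_hom comp_idt[OF idt_hom])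

lemma iso_comp:
  assumes i: "is_iso C i" "i \<in> hom C x y" and j: "is_iso C j" "j \<in> hom C y z"
  shows "is_iso C (Comp C j i)"
proof -
  obtain i' where i': "i' \<in> hom C y x" "Comp C i' i = Idt C x" "Comp C i i' = Idt C y" using i by (rule is_isoE)
  obtain j' where j': "j' \<in> hom C z y" "Comp C j' j = Idt C y" "Comp C j j' = Idt C z" using j by (rule is_isoE)
  show ?thesis
  proof (rule is_isoI[OF comp_hom[OF i(2) j(2)] comp_hom[OF j'(1) i'(1)]])
    show "Comp C (Comp C i' j') (Comp C j i) = Idt C x"
      using comp_assoc[OF comp_hom[OF i(2) j(2)] j'(1) i'(1)] comp_assoc[OF i(2) j(2) j'(1)] i'(2) j'(2) idt_comp[OF i(2)]
      by simp
    show "Comp C (Comp C j i) (Comp C i' j') = Idt C z"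
      using comp_assoc[OF comp_hom[OF j'(1) i'(1)] i(2) j(2)] comp_assoc[OF j'(1) i'(1) i(2)] i'(3) j'(3) idt_comp[OF j'(1)]
      by simp
  qed
qed

text \<open>Once monicity is phrased as a property of the kernel pair, any functor preserving
  pullbacks visibly preserves it.\<close>

lemma monic_iff_pullback:
  assumes m: "m \<in> hom C x y" shows "monic C m \<longleftrightarrow> is_pullback C m m (Idt C x) (Idt C x)"
proof
  have x: "Idt C x \<in> hom C x x" using hom_obj[OF m] idt_hom by blast
  show "is_pullback C m m (Idt C x) (Idt C x)" if "monic C m"
  proof (rule is_pullbackI[OF m m x x refl])
    fix v p q assume v: "p \<in> hom C v x" "q \<in> hom C v x" "Comp C m p = Comp C m q"
    then have "p = q" by (rule monicD[OF that m])
    then show "\<exists>u\<in>hom C v x. Comp C (Idt C x) u = p \<and> Comp C (Idt C x) u = q"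
      using v idt_comp by auto
  qed (use idt_comp in metis)
  assume pb: "is_pullback C m m (Idt C x) (Idt C x)"
  show "monic C m"
  proof (rule monicI[OF m])
    fix v g h assume v: "g \<in> hom C v x" "h \<in> hom C v x" "Comp C m g = Comp C m h"
    then obtain u where "u \<in> hom C v x" "Comp C (Idt C x) u = g" "Comp C (Idt C x) u = h"
      using is_pullback_univ[OF pb m m x v] by blast
    then show "g = h" by simp
  qed
qed

section \<open>Subobjects and jointly monic pairs\<close>

lemma subobj_self: "monic C m \<Longrightarrow> m \<in> subobj C m"
  using iso_idt idt_hom comp_idt[of m "Dom C m" "Cod C m"] dom_obj[of m]
  by (auto simp: subobj_def monic_def hom_def)

lemma subobj_iso_subset:
  assumes m: "m \<in> hom C x y" and i: "is_iso C i" "i \<in> hom C x' x"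
  shows "subobj C (Comp C m i) \<subseteq> subobj C m"
proof
  fix n assume n: "n \<in> subobj C (Comp C m i)"
  note mi = comp_hom[OF i(2) m]
  obtain j where j: "is_iso C j" "j \<in> hom C (Dom C n) x'" "Comp C (Comp C m i) j = n" and n': "monic C n" "Cod C n = y"
    using n homD[OF mi] by (auto simp: subobj_def)
  show "n \<in> subobj C m"
    using n' homD[OF m] iso_comp[OF j(1,2) i] comp_hom[OF j(2) i(2)] comp_assoc[OF j(2) i(2) m] j(3)
    by (auto simp: subobj_def)
qed

lemma subobj_iso:
  assumes m: "m \<in> hom C x y" and i: "is_iso C i" "i \<in> hom C x' x"
  shows "subobj C (Comp C m i) = subobj C m"
proof
  obtain j where j: "j \<in> hom C x x'" "Comp C i j = Idt C x" "is_iso C j" using i by (rule is_isoE)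
  show "subobj C m \<subseteq> subobj C (Comp C m i)"
    using subobj_iso_subset[OF comp_hom[OF i(2) m] j(3,1)] comp_assoc[OF j(1) i(2) m] j(2) comp_idt[OF m] by simp
qed (rule subobj_iso_subset[OF assms])

text \<open>A replacement for monicity of the pairing that mentions no chosen product. A functor may
  fail to carry the chosen product to a product, so this is the form in which the legs of a relation
  are transported.\<close>

definition jointly_monic :: "'a \<Rightarrow> 'a \<Rightarrow> bool" where
  "jointly_monic f g \<longleftrightarrow> (\<forall>v. \<forall>u \<in> hom C v (Dom C f). \<forall>u' \<in> hom C v (Dom C f).
    Comp C f u = Comp C f u' \<longrightarrow> Comp C g u = Comp C g u' \<longrightarrow> u = u')"

lemma jointly_monicD:
  assumes "jointly_monic f g" "f \<in> hom C w x" "u \<in> hom C v w" "u' \<in> hom C v w"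
    "Comp C f u = Comp C f u'" "Comp C g u = Comp C g u'"
  shows "u = u'"
  using assms by (auto simp: jointly_monic_def hom_def)

lemma is_pullback_jointly_monic:
  assumes "is_pullback C f g p q" shows "jointly_monic p q"
proof -
  obtain x y z where fg: "f \<in> hom C x z" "g \<in> hom C y z" using assms by (rule is_pullback_homE)
  obtain w where w: "p \<in> hom C w x" using is_pullback_dom[OF assms fg(1)] by blast
  show ?thesis
    unfolding jointly_monic_def using is_pullback_uniq[OF assms fg w] homD(2)[OF w] by blast
qed

section \<open>The chosen binary products\<close>

lemma product_homs:
  assumes "has_product C x y"
  shows "pr1 C x y \<in> hom C (prod_obj C x y) x" "pr2 C x y \<in> hom C (prod_obj C x y) y"
    and pairing_ex1: "f \<in> hom C w x \<Longrightarrow> g \<in> hom C w y \<Longrightarrow>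
      \<exists>!u. u \<in> hom C w (prod_obj C x y) \<and> Comp C (pr1 C x y) u = f \<and> Comp C (pr2 C x y) u = g"
proof -
  have "\<exists>pq. is_product C x y (fst pq) (snd pq)" using assms by (auto simp: has_product_def)
  then have "is_product C x y (fst (prod_cone C x y)) (snd (prod_cone C x y))"
    unfolding prod_cone_def by (rule someI_ex)
  then have p: "is_product C x y (pr1 C x y) (pr2 C x y)" by (simp add: pr1_def pr2_def)
  then show "pr1 C x y \<in> hom C (prod_obj C x y) x" "pr2 C x y \<in> hom C (prod_obj C x y) y"
    by (auto simp: is_product_def hom_def prod_obj_def)
  show "\<exists>!u. u \<in> hom C w (prod_obj C x y) \<and> Comp C (pr1 C x y) u = f \<and> Comp C (pr2 C x y) u = g"
    if "f \<in> hom C w x" "g \<in> hom C w y"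
    using p that unfolding is_product_def prod_obj_def by blast
qed

lemma pairing:
  assumes "has_product C x y" "f \<in> hom C w x" "g \<in> hom C w y"
  shows "pairing C x y f g \<in> hom C w (prod_obj C x y)"
    "Comp C (pr1 C x y) (pairing C x y f g) = f" "Comp C (pr2 C x y) (pairing C x y f g) = g"
proof -
  have "\<exists>!u. u \<in> hom C (Dom C f) (prod_obj C x y) \<and> Comp C (pr1 C x y) u = f \<and> Comp C (pr2 C x y) u = g"
    using pairing_ex1[OF assms] homD(2)[OF assms(2)] by simp
  from theI'[OF this] show "pairing C x y f g \<in> hom C w (prod_obj C x y)"
    "Comp C (pr1 C x y) (pairing C x y f g) = f" "Comp C (pr2 C x y) (pairing C x y f g) = g"
    using homD(2)[OF assms(2)] by (auto simp: pairing_def)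
qed

lemma pairing_unique:
  assumes "has_product C x y" "u \<in> hom C w (prod_obj C x y)"
  shows "pairing C x y (Comp C (pr1 C x y) u) (Comp C (pr2 C x y) u) = u"
proof -
  note p = product_homs[OF assms(1)]
  note h = comp_hom[OF assms(2) p(1)] comp_hom[OF assms(2) p(2)]
  show ?thesis using pairing[OF assms(1) h] pairing_ex1[OF assms(1) h] assms(2) by blast
qed

lemma pairing_comp:
  assumes "has_product C x y" "f \<in> hom C w x" "g \<in> hom C w y" "u \<in> hom C v w"
  shows "Comp C (pairing C x y f g) u = pairing C x y (Comp C f u) (Comp C g u)"
  using pairing_unique[OF assms(1) comp_hom[OF assms(4) pairing(1)[OF assms(1-3)]]]
    comp_assoc[OF assms(4) pairing(1)[OF assms(1-3)] product_homs(1)[OF assms(1)]]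
    comp_assoc[OF assms(4) pairing(1)[OF assms(1-3)] product_homs(2)[OF assms(1)]]
    pairing(2,3)[OF assms(1-3)] by simp

lemma monic_pairing_iff:
  assumes "has_product C x y" "f \<in> hom C w x" "g \<in> hom C w y"
  shows "monic C (pairing C x y f g) \<longleftrightarrow> jointly_monic f g"
proof
  note p = pairing[OF assms]
  show "jointly_monic f g" if "monic C (pairing C x y f g)"
    unfolding jointly_monic_def
  proof (intro allI ballI impI)
    fix v u u' assume "u \<in> hom C v (Dom C f)" "u' \<in> hom C v (Dom C f)"
      "Comp C f u = Comp C f u'" "Comp C g u = Comp C g u'"
    then show "u = u'"
      using monicD[OF that p(1)] pairing_comp[OF assms] homD(2)[OF assms(2)] by metis
  qed
  show "monic C (pairing C x y f g)" if "jointly_monic f g"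
  proof (rule monicI[OF p(1)])
    fix v u u' assume u: "u \<in> hom C v w" "u' \<in> hom C v w"
      and eq: "Comp C (pairing C x y f g) u = Comp C (pairing C x y f g) u'"
    have "Comp C f u = Comp C f u'" "Comp C g u = Comp C g u'"
      using eq comp_assoc[OF u(1) p(1)] comp_assoc[OF u(2) p(1)] product_homs[OF assms(1)] p(2,3) by metis+
    then show "u = u'" using jointly_monicD[OF that assms(2) u] by blast
  qed
qed

end

section \<open>Spans and their images\<close>

context category begin

lemma epi_mono_factD:
  assumes "epi_mono_fact C f e m" "f \<in> hom C w x"
  shows "e \<in> hom C w (Dom C m)" "m \<in> hom C (Dom C m) x" "epic C e" "monic C m" "Comp C m e = f"
proof -
  have em: "e \<in> hom C (Dom C e) (Dom C m)" "m \<in> hom C (Dom C m) (Cod C m)"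
    using assms(1) by (auto simp: epi_mono_fact_def epic_def monic_def hom_def)
  show c: "Comp C m e = f" using assms(1) by (simp add: epi_mono_fact_def)
  then have "Dom C e = w" "Cod C m = x" using comp_hom[OF em] homD[OF assms(2)] by (auto simp: hom_def)
  then show "e \<in> hom C w (Dom C m)" "m \<in> hom C (Dom C m) x" using em by auto
  show "epic C e" "monic C m" using assms(1) by (auto simp: epi_mono_fact_def)
qed

lemma epi_mono_factI:
  assumes "epic C e" "e \<in> hom C w v" "monic C m" "m \<in> hom C v x"
  shows "epi_mono_fact C (Comp C m e) e m"
  using assms by (auto simp: epi_mono_fact_def hom_def)

text \<open>\<open>rel_rep\<close> is an arbitrary monomorphism of the class. It differs from the
  defining one by an isomorphism, so \<open>subobj_iso\<close> recovers the whole class from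
  it.\<close>

lemma relationsD:
  assumes "r \<in> relations C x y"
  shows "has_product C x y" "monic C (rel_rep r)" "rel_rep r \<in> hom C (Dom C (rel_rep r)) (prod_obj C x y)"
    "subobj C (rel_rep r) = r"
proof -
  obtain m where r: "r = subobj C m" and m: "monic C m" "Cod C m = prod_obj C x y" and xy: "has_product C x y"
    using assms by (auto simp: relations_def subobjects_def split: if_splits)
  show "has_product C x y" by (rule xy)
  have "rel_rep r \<in> r" unfolding rel_rep_def using subobj_self[OF m(1)] r by (metis someI_ex)
  then obtain i where i: "i \<in> hom C (Dom C (rel_rep r)) (Dom C m)" "is_iso C i" "Comp C m i = rel_rep r"
    and n: "monic C (rel_rep r)" "Cod C (rel_rep r) = Cod C m" using r by (auto simp: subobj_def)
  show "monic C (rel_rep r)" by (rule n(1))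
  show "rel_rep r \<in> hom C (Dom C (rel_rep r)) (prod_obj C x y)"
    using n m by (auto simp: monic_def hom_def)
  have "m \<in> hom C (Dom C m) (prod_obj C x y)" using m by (auto simp: monic_def hom_def)
  from subobj_iso[OF this i(2,1)] show "subobj C (rel_rep r) = r" by (simp add: i(3) r)
qed

lemma subobj_relation:
  assumes "has_product C x y" "monic C m" "m \<in> hom C w (prod_obj C x y)"
  shows "subobj C m \<in> relations C x y"
  using assms by (auto simp: relations_def subobjects_def hom_def)

lemma legs_hom:
  assumes "r \<in> relations C x y"
  shows "src_leg C x y r \<in> hom C (Dom C (rel_rep r)) x" "tgt_leg C x y r \<in> hom C (Dom C (rel_rep r)) y"
    "pairing C x y (src_leg C x y r) (tgt_leg C x y r) = rel_rep r"
  unfolding src_leg_def tgt_leg_def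
  using comp_hom[OF relationsD(3)[OF assms] product_homs(1)[OF relationsD(1)[OF assms]]]
    comp_hom[OF relationsD(3)[OF assms] product_homs(2)[OF relationsD(1)[OF assms]]]
    pairing_unique[OF relationsD(1,3)[OF assms]] by auto

lemma legs_jointly_monic: "r \<in> relations C x y \<Longrightarrow> jointly_monic (src_leg C x y r) (tgt_leg C x y r)"
  using monic_pairing_iff[OF relationsD(1) legs_hom(1,2)] legs_hom(3) relationsD(2) by metis

text \<open>Over a terminal object every pair of arrows with common domain commutes. The projections
  thereby come within reach of functors known only to preserve pullbacks.\<close>

lemma product_pullback:
  assumes "has_product C x y" "terminal C t" "a \<in> hom C x t" "b \<in> hom C y t"
  shows "is_pullback C a b (pr1 C x y) (pr2 C x y)"
proof -
  note p = product_homs[OF assms(1)]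
  show ?thesis
  proof (rule is_pullbackI[OF assms(3,4) p(1,2)])
    show "Comp C a (pr1 C x y) = Comp C b (pr2 C x y)"
      using comp_hom[OF p(1) assms(3)] comp_hom[OF p(2) assms(4)] assms(2) hom_obj(1)[OF p(1)]
      by (auto simp: terminal_def)
    fix v f g assume fg: "f \<in> hom C v x" "g \<in> hom C v y"
    show "\<exists>u\<in>hom C v (prod_obj C x y). Comp C (pr1 C x y) u = f \<and> Comp C (pr2 C x y) u = g"
      using pairing[OF assms(1) fg] by blast
  next
    fix v u u' assume "u \<in> hom C v (prod_obj C x y)" "u' \<in> hom C v (prod_obj C x y)"
      "Comp C (pr1 C x y) u = Comp C (pr1 C x y) u'" "Comp C (pr2 C x y) u = Comp C (pr2 C x y) u'"
    then show "u = u'" using pairing_unique[OF assms(1)] by metis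
  qed
qed

end

text \<open>Binary products may be missing in general, but here the span itself completes the cospan
  over a terminal object to a commutative square, and \<open>pullback_exists\<close> applies.
  Whenever a span is at hand, its pairing is therefore meaningful.\<close>

lemma (in regular_category) has_product_span:
  assumes f: "f \<in> hom C w x" and g: "g \<in> hom C w y" shows "has_product C x y"
proof -
  obtain t where t: "terminal C t" using terminal_exists by blast
  obtain a where a: "a \<in> hom C x t" using t hom_obj(2)[OF f] by (auto simp: terminal_def)
  obtain b where b: "b \<in> hom C y t" using t hom_obj(2)[OF g] by (auto simp: terminal_def)
  have uniq: "u = u'" if "u \<in> hom C v t" "u' \<in> hom C v t" for u u' v
    using t that hom_obj(1)[OF that(1)] by (auto simp: terminal_def)
  have "Comp C a f = Comp C b g" by (rule uniq[OF comp_hom[OF f a] comp_hom[OF g b]])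
  then have "comm_square C a b f g" by (rule comm_squareI[OF a b f g])
  then obtain p q where pq: "is_pullback C a b p q" using pullback_exists unfolding has_pullback_def by blast
  obtain v where p: "p \<in> hom C v x" using is_pullback_dom[OF pq a] by blast
  note q = is_pullback_square(1)[OF pq a b p]
  have "is_product C x y p q"
    unfolding is_product_def
  proof (intro conjI allI ballI)
    show "p \<in> Arr C" "q \<in> Arr C" "Dom C p = Dom C q" "Cod C p = x" "Cod C q = y"
      using p q by (auto simp: hom_def)
    fix w' f' g' assume f': "f' \<in> hom C w' x" and g': "g' \<in> hom C w' y"
    have "Comp C a f' = Comp C b g'" by (rule uniq[OF comp_hom[OF f' a] comp_hom[OF g' b]])
    then obtain u where "u \<in> hom C w' v" "Comp C p u = f'" "Comp C q u = g'"
      using is_pullback_univ[OF pq a b p f' g'] by blast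
    then show "\<exists>!u. u \<in> hom C w' (Dom C p) \<and> Comp C p u = f' \<and> Comp C q u = g'"
      unfolding homD(2)[OF p] using is_pullback_uniq[OF pq a b p] by metis
  qed
  then show ?thesis by (auto simp: has_product_def)
qed

section \<open>Spans weighted by the degree of their image epimorphism\<close>

locale graded_category = regular_category C + degree_function C \<delta>
  for C :: "('o, 'a) cat" and \<delta> :: "'a \<Rightarrow> 'k::field"
begin

text \<open>For a span \<open>x \<leftarrow> w \<rightarrow> y\<close> with \<open>w \<twoheadrightarrow> r \<subseteq> x \<times> y\<close>, the arrow
  \<open>c * \<delta> (w \<twoheadrightarrow> r) * \<langle>r\<rangle>\<close> of \<open>\<T>\<^sup>0\<close>. With this normalization spans compose by arbitrary
  pullbacks, and no images have to be taken.\<close>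

definition span :: "'o \<Rightarrow> 'o \<Rightarrow> 'a \<Rightarrow> 'a \<Rightarrow> 'k \<Rightarrow> 'a set \<Rightarrow>\<^sub>0 'k" where
  "span x y f g c = (let em = SOME em. epi_mono_fact C (pairing C x y f g) (fst em) (snd em)
    in Poly_Mapping.single (subobj C (snd em)) (c * \<delta> (fst em)))"

text \<open>The span \<open>(f, g)\<close> is composed first and \<open>(h, k)\<close> second;
  \<open>c\<close> stands for the product of their coefficients. A missing pullback gives zero, in
  agreement with the composition of \<open>T0\<close>.\<close>

definition span_comp :: "'o \<Rightarrow> 'o \<Rightarrow> 'a \<Rightarrow> 'a \<Rightarrow> 'a \<Rightarrow> 'a \<Rightarrow> 'k \<Rightarrow> 'a set \<Rightarrow>\<^sub>0 'k" where
  "span_comp x z f g h k c = (if has_pullback C g h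
    then let pq = SOME pq. is_pullback C g h (fst pq) (snd pq)
      in span x z (Comp C f (fst pq)) (Comp C k (snd pq)) c
    else 0)"

lemma degree_iso: 
  assumes "is_iso C i" "i \<in> hom C x y" shows "\<delta> i = 1"
  using degree_pullback[OF iso_epic[OF iso_idt idt_hom] is_pullback_iso_idt[OF assms]]
    degree_idt hom_obj(2)[OF assms(2)] by simp

lemma degree_comp_hom:
  assumes "epic C e" "e \<in> hom C x y" "epic C e'" "e' \<in> hom C y z"
  shows "\<delta> (Comp C e' e) = \<delta> e' * \<delta> e"
  using degree_comp[OF assms(1,3)] assms(2,4) by (simp add: hom_def)

text \<open>Two image factorizations differ by an isomorphism, which affects neither the subobject
  nor the degree. Hence the factorization picked by \<open>SOME\<close> may be replaced by any
  other.\<close>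

lemma span_fact:
  assumes "f \<in> hom C w x" "g \<in> hom C w y" "epi_mono_fact C (pairing C x y f g) e m"
  shows "span x y f g c = Poly_Mapping.single (subobj C m) (c * \<delta> e)"
proof -
  note p = pairing(1)[OF has_product_span[OF assms(1,2)] assms(1,2)]
  define em where "em = (SOME em. epi_mono_fact C (pairing C x y f g) (fst em) (snd em))"
  obtain e0 m0 where em: "em = (e0, m0)" by (cases em)
  have "\<exists>em. epi_mono_fact C (pairing C x y f g) (fst em) (snd em)" using assms(3) by auto
  then have "epi_mono_fact C (pairing C x y f g) (fst em) (snd em)" unfolding em_def by (rule someI_ex)
  then have f0: "epi_mono_fact C (pairing C x y f g) e0 m0" by (simp add: em)
  note d = epi_mono_factD[OF assms(3) p] and d0 = epi_mono_factD[OF f0 p]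
  obtain i where "i \<in> hom C (Cod C e0) (Cod C e)" "is_iso C i" "Comp C i e0 = e" "Comp C m i = m0"
    using image_unique[OF f0 assms(3)] by blast
  then have i: "i \<in> hom C (Dom C m0) (Dom C m)" "is_iso C i" "Comp C i e0 = e" "Comp C m i = m0"
    using homD(3)[OF d(1)] homD(3)[OF d0(1)] by auto
  have "subobj C m0 = subobj C m" using subobj_iso[OF d(2) i(2,1)] i(4) by simp
  moreover have "\<delta> e = \<delta> e0"
    using degree_comp_hom[OF d0(3,1) iso_epic[OF i(2,1)] i(1)] degree_iso[OF i(2,1)] i(3) by simp
  ultimately show ?thesis by (simp add: span_def em_def[symmetric] em)
qed

text \<open>The pairing is its own image here, with the identity as epimorphism, so no degree factor
  appears.\<close>

lemma span_jointly_monic: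
  assumes "f \<in> hom C w x" "g \<in> hom C w y" "jointly_monic f g"
  shows "span x y f g c = Poly_Mapping.single (subobj C (pairing C x y f g)) c"
proof -
  note P = has_product_span[OF assms(1,2)]
  note p = pairing(1)[OF P assms(1,2)]
  have w: "w \<in> Obj C" by (rule hom_obj[OF p])
  have "epi_mono_fact C (Comp C (pairing C x y f g) (Idt C w)) (Idt C w) (pairing C x y f g)"
    using monic_pairing_iff[OF P assms(1,2)] assms(3)
    by (intro epi_mono_factI[OF iso_epic[OF iso_idt[OF w] idt_hom[OF w]] idt_hom[OF w] _ p]) simp
  then show ?thesis using span_fact[OF assms(1,2)] comp_idt[OF p] degree_idt[OF w] by simp
qed

text \<open>The bridge from spans back to relations: every span is the pair of chosen legs of a
  relation, precomposed with one epimorphism, and the degree of that epimorphism is the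
  scalar.\<close>

lemma span_relation:
  assumes f: "f \<in> hom C w x" and g: "g \<in> hom C w y"
  obtains r e where "r \<in> relations C x y" "epic C e" "e \<in> hom C w (Dom C (rel_rep r))"
    "f = Comp C (src_leg C x y r) e" "g = Comp C (tgt_leg C x y r) e"
    "\<And>c. span x y f g c = Poly_Mapping.single r (c * \<delta> e)"
proof -
  note P = has_product_span[OF f g]
  note p = pairing[OF P f g] and pr = product_homs(1,2)[OF P]
  obtain e m where em: "epi_mono_fact C (pairing C x y f g) e m" using image_exists homD(1)[OF p(1)] by blast
  note d = epi_mono_factD[OF em p(1)]
  define r where "r = subobj C m"
  have r: "r \<in> relations C x y" unfolding r_def by (rule subobj_relation[OF P d(4,2)])
  note rr = relationsD[OF r] and l = legs_hom[OF r]
  have "rel_rep r \<in> subobj C m" using subobj_self[OF rr(2)] rr(4) r_def by simp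
  then obtain i where i: "i \<in> hom C (Dom C (rel_rep r)) (Dom C m)" "is_iso C i" "Comp C m i = rel_rep r"
    by (auto simp: subobj_def)
  obtain j where j: "j \<in> hom C (Dom C m) (Dom C (rel_rep r))" "Comp C i j = Idt C (Dom C m)" "is_iso C j"
    using i(2,1) by (rule is_isoE)
  \<comment> \<open>The isomorphism from the monomorphism of the factorization to the chosen
    representative of \<open>r\<close> is moved into the epimorphism.\<close>
  define e' where "e' = Comp C j e"
  have e': "e' \<in> hom C w (Dom C (rel_rep r))" "epic C e'"
    unfolding e'_def using comp_hom[OF d(1) j(1)] epic_comp[OF d(3,1) iso_epic[OF j(3,1)] j(1)] by auto
  have "Comp C (rel_rep r) j = m"
    using comp_assoc[OF j(1) i(1) d(2)] i(3) j(2) comp_idt[OF d(2)] by simp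
  then have fact: "Comp C (rel_rep r) e' = pairing C x y f g"
    unfolding e'_def using comp_assoc[OF d(1) j(1) rr(3)] d(5) by simp
  show ?thesis
  proof (rule that[OF r e'(2,1)])
    show "f = Comp C (src_leg C x y r) e'"
      unfolding src_leg_def using comp_assoc[OF e'(1) rr(3) pr(1)] fact p(2) by simp
    show "g = Comp C (tgt_leg C x y r) e'"
      unfolding tgt_leg_def using comp_assoc[OF e'(1) rr(3) pr(2)] fact p(3) by simp
    show "span x y f g c = Poly_Mapping.single r (c * \<delta> e')" for c
      using span_fact[OF f g, of e' "rel_rep r" c] epi_mono_factI[OF e'(2,1) rr(2,3)] fact rr(4) by simp
  qed
qed

text \<open>The legs of a relation are jointly monic, so its weight as a span is trivial; relations
  thus sit among the spans.\<close>

lemma single_relation: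
  assumes "r \<in> relations C x y"
  shows "Poly_Mapping.single r c = span x y (src_leg C x y r) (tgt_leg C x y r) c"
  using span_jointly_monic[OF legs_hom(1,2) legs_jointly_monic] assms legs_hom(3) relationsD(4) by simp

lemma keys_span:
  assumes "f \<in> hom C w x" "g \<in> hom C w y"
  shows "Poly_Mapping.keys (span x y f g c) \<subseteq> relations C x y"
  by (rule span_relation[OF assms]) auto

lemma span_zero [simp]: "span x y f g 0 = 0"
  by (simp add: span_def Let_def)

text \<open>Precomposing with an epimorphism keeps the image and prolongs the epimorphic part, so
  the degree picks up exactly one factor. The normalization of \<open>span\<close> is made for this
  rule.\<close>

lemma span_precomp_epi:
  assumes f: "f \<in> hom C w x" and g: "g \<in> hom C w y" and u: "epic C u" "u \<in> hom C v w"
  shows "span x y (Comp C f u) (Comp C g u) c = span x y f g (c * \<delta> u)"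
proof -
  note P = has_product_span[OF f g]
  note p = pairing(1)[OF P f g]
  obtain e m where em: "epi_mono_fact C (pairing C x y f g) e m" using image_exists homD(1)[OF p] by blast
  note d = epi_mono_factD[OF em p]
  have "epi_mono_fact C (Comp C m (Comp C e u)) (Comp C e u) m"
    by (rule epi_mono_factI[OF epic_comp[OF u d(3,1)] comp_hom[OF u(2) d(1)] d(4,2)])
  also have "Comp C m (Comp C e u) = pairing C x y (Comp C f u) (Comp C g u)"
    using comp_assoc[OF u(2) d(1,2)] d(5) pairing_comp[OF P f g u(2)] by simp
  finally show ?thesis
    using span_fact[OF comp_hom[OF u(2) f] comp_hom[OF u(2) g]] span_fact[OF f g em] degree_comp_hom[OF u d(3,1)]
    by (simp add: mult_ac)
qed

lemma span_comp_zero [simp]: "span_comp x z f g h k 0 = 0"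
  by (simp add: span_comp_def Let_def)

context
  fixes f g h k w v x y z
  assumes f: "f \<in> hom C w x" and g: "g \<in> hom C w y" and h: "h \<in> hom C v y" and k: "k \<in> hom C v z"
begin

text \<open>Two pullbacks of the same cospan differ by an isomorphism, an epimorphism of degree one,
  so \<open>span_precomp_epi\<close> makes the choice of pullback immaterial.\<close>

lemma span_comp_pullback:
  assumes pq: "is_pullback C g h p q"
  shows "span_comp x z f g h k c = span x z (Comp C f p) (Comp C k q) c"
proof -
  define pq0 where "pq0 = (SOME pq. is_pullback C g h (fst pq) (snd pq))"
  obtain p0 q0 where pq0: "pq0 = (p0, q0)" by (cases pq0)
  have "\<exists>pq. is_pullback C g h (fst pq) (snd pq)" using pq by auto
  then have "is_pullback C g h (fst pq0) (snd pq0)" unfolding pq0_def by (rule someI_ex)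
  then have pb0: "is_pullback C g h p0 q0" by (simp add: pq0)
  have p: "p \<in> hom C (Dom C p) w" by (rule is_pullback_dom[OF pq g])
  have p0: "p0 \<in> hom C (Dom C p0) w" by (rule is_pullback_dom[OF pb0 g])
  note q = is_pullback_square(1)[OF pq g h p] and q0 = is_pullback_square(1)[OF pb0 g h p0]
  obtain i where i: "i \<in> hom C (Dom C p0) (Dom C p)" "is_iso C i" "Comp C p i = p0" "Comp C q i = q0"
    using is_pullback_iso[OF pq pb0 p p0] .
  have "span x z (Comp C f p0) (Comp C k q0) c = span x z (Comp C (Comp C f p) i) (Comp C (Comp C k q) i) c"
    using comp_assoc[OF i(1) p f] comp_assoc[OF i(1) q k] i(3,4) by simp
  also have "\<dots> = span x z (Comp C f p) (Comp C k q) c"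
    using span_precomp_epi[OF comp_hom[OF p f] comp_hom[OF q k] iso_epic[OF i(2,1)] i(1)] degree_iso[OF i(2,1)]
    by simp
  finally show ?thesis
    using pq by (auto simp: span_comp_def has_pullback_def Let_def pq0_def[symmetric] pq0)
qed

end

text \<open>The reason why images can be postponed: the pullback of the enlarged spans covers the
  pullback of the original ones by a composite of pullbacks of \<open>e\<close> and
  \<open>d\<close>, whose degree is the product of their degrees.\<close>

lemma span_comp_epi:
  assumes f: "f \<in> hom C w x" and g: "g \<in> hom C w y" and h: "h \<in> hom C v y" and k: "k \<in> hom C v z"
    and e: "epic C e" "e \<in> hom C w' w" and d: "epic C d" "d \<in> hom C v' v"
  shows "span_comp x z (Comp C f e) (Comp C g e) (Comp C h d) (Comp C k d) c =
    span_comp x z f g h k (c * \<delta> e * \<delta> d)"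
proof (cases "has_pullback C g h")
  case True
  then obtain p q where pq: "is_pullback C g h p q" by (auto simp: has_pullback_def)
  have p: "p \<in> hom C (Dom C p) w" by (rule is_pullback_dom[OF pq g])
  note q = is_pullback_square(1)[OF pq g h p]
  \<comment> \<open>\<open>e\<close> is pulled back along \<open>p\<close>, and then
    \<open>d\<close> along the resulting arrow. Both pullbacks exist because \<open>e\<close> and
    \<open>d\<close> are epic, and the epimorphisms \<open>t\<close> and \<open>t'\<close> obtained
    keep the degrees of \<open>e\<close> and \<open>d\<close>.\<close>
  have "has_pullback C e p"
    by (rule epi_pullback_exists[OF e(1) homD(1)[OF p]]) (simp add: homD(3)[OF p] homD(3)[OF e(2)])
  then obtain s t where st: "is_pullback C e p s t" by (auto simp: has_pullback_def)
  have s: "s \<in> hom C (Dom C s) w'" by (rule is_pullback_dom[OF st e(2)])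
  note t = is_pullback_square[OF st e(2) p s] and te = epi_pullback[OF st e(1)]
  note qt = comp_hom[OF t(1) q]
  have "has_pullback C d (Comp C q t)"
    by (rule epi_pullback_exists[OF d(1) homD(1)[OF qt]]) (simp add: homD(3)[OF qt] homD(3)[OF d(2)])
  then obtain s' t' where st': "is_pullback C d (Comp C q t) s' t'" by (auto simp: has_pullback_def)
  have s': "s' \<in> hom C (Dom C s') v'" by (rule is_pullback_dom[OF st' d(2)])
  note t' = is_pullback_square[OF st' d(2) qt s'] and te' = epi_pullback[OF st' d(1)]
  note tt' = comp_hom[OF t'(1) t(1)]
  \<comment> \<open>Pasting on one leg and then on the other shows that the object just built is the
    pullback of the enlarged spans.\<close>
  have "is_pullback C (Comp C g e) h s (Comp C q t)"
    using is_pullback_paste[OF is_pullback_sym[OF pq] is_pullback_sym[OF st]] by (rule is_pullback_sym)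
  then have "is_pullback C (Comp C g e) (Comp C h d) (Comp C s t') s'"
    by (rule is_pullback_paste[OF _ is_pullback_sym[OF st']])
  from span_comp_pullback[OF comp_hom[OF e(2) f] comp_hom[OF e(2) g] comp_hom[OF d(2) h] comp_hom[OF d(2) k] this]
  have "span_comp x z (Comp C f e) (Comp C g e) (Comp C h d) (Comp C k d) c =
      span x z (Comp C (Comp C f e) (Comp C s t')) (Comp C (Comp C k d) s') c" .
  also have "Comp C (Comp C f e) (Comp C s t') = Comp C (Comp C f p) (Comp C t t')"
    using comp_assoc[OF comp_hom[OF t'(1) s] e(2) f] comp_assoc[OF t'(1) s e(2)] t(2)
      comp_assoc[OF t'(1) t(1) p] comp_assoc[OF tt' p f] by simp
  also have "Comp C (Comp C k d) s' = Comp C (Comp C k q) (Comp C t t')"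
    using comp_assoc[OF s' d(2) k] t'(2) comp_assoc[OF t'(1) t(1) q] comp_assoc[OF tt' q k] by simp
  also have "span x z (Comp C (Comp C f p) (Comp C t t')) (Comp C (Comp C k q) (Comp C t t')) c =
      span x z (Comp C f p) (Comp C k q) (c * \<delta> (Comp C t t'))"
    by (rule span_precomp_epi[OF comp_hom[OF p f] comp_hom[OF q k] epic_comp[OF te' t'(1) te t(1)] tt'])
  also have "\<delta> (Comp C t t') = \<delta> e * \<delta> d"
    using degree_comp_hom[OF te' t'(1) te t(1)] degree_pullback[OF e(1) st] degree_pullback[OF d(1) st'] by simp
  also have "span x z (Comp C f p) (Comp C k q) (c * (\<delta> e * \<delta> d)) = span_comp x z f g h k (c * \<delta> e * \<delta> d)"
    using span_comp_pullback[OF f g h k pq] by (simp add: mult.assoc)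
  finally show ?thesis .
next
  case False
  note ge = comp_hom[OF e(2) g] and hd = comp_hom[OF d(2) h]
  \<comment> \<open>A pullback upstairs would give a commutative square over \<open>g\<close> and
    \<open>h\<close>, hence a pullback downstairs; both composites are therefore zero.\<close>
  have "\<not> has_pullback C (Comp C g e) (Comp C h d)"
  proof
    assume "has_pullback C (Comp C g e) (Comp C h d)"
    then obtain p q where pq: "is_pullback C (Comp C g e) (Comp C h d) p q" by (auto simp: has_pullback_def)
    have p: "p \<in> hom C (Dom C p) w'" by (rule is_pullback_dom[OF pq ge])
    note q = is_pullback_square[OF pq ge hd p]
    have "comm_square C g h (Comp C e p) (Comp C d q)"
      using q(2) comp_assoc[OF p e(2) g] comp_assoc[OF q(1) d(2) h]
      by (intro comm_squareI[OF g h comp_hom[OF p e(2)] comp_hom[OF q(1) d(2)]]) simp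
    then show False using pullback_exists False by blast
  qed
  then show ?thesis using False by (simp add: span_comp_def)
qed

section \<open>The category of relations\<close>

lemma T0_sel [simp]:
  "LObj (T0 C \<delta>) = Obj C"
  "LHom (T0 C \<delta>) x y = {a. Poly_Mapping.keys a \<subseteq> relations C x y}"
  by (simp_all add: T0_def)

text \<open>The arbitrary choices of pullback and factorization are made by identical expressions on
  both sides, so unfolding suffices. Zero coefficients are split off because the corresponding
  \<open>single\<close> then has no keys.\<close>

lemma T0_comp_single:
  assumes "r \<in> relations C x y" "s \<in> relations C y z"
  shows "LComp (T0 C \<delta>) x y z (Poly_Mapping.single s d) (Poly_Mapping.single r c) =
    span_comp x z (src_leg C x y r) (tgt_leg C x y r) (src_leg C y z s) (tgt_leg C y z s) (c * d)"
  by (cases "c = 0"; cases "d = 0")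
    (simp_all add: T0_def span_comp_def span_def Let_def case_prod_beta rel_pullback_exists_def rel_pullback_def
      rel_star_def rel_epi_def rel_fact_def rel_span_def mult_ac)

text \<open>The spans are multiples of relations by the degrees of two epimorphisms, and
  \<open>span_comp_epi\<close> absorbs exactly these two factors. From here on composition in
  \<open>T0\<close> is a matter of pullbacks alone.\<close>

lemma T0_comp_span:
  assumes f: "f \<in> hom C w x" and g: "g \<in> hom C w y" and h: "h \<in> hom C v y" and k: "k \<in> hom C v z"
  shows "LComp (T0 C \<delta>) x y z (span y z h k d) (span x y f g c) = span_comp x z f g h k (c * d)"
proof -
  obtain r e where r: "r \<in> relations C x y" and e: "epic C e" "e \<in> hom C w (Dom C (rel_rep r))"
    and fg: "f = Comp C (src_leg C x y r) e" "g = Comp C (tgt_leg C x y r) e"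
    "\<And>c. span x y f g c = Poly_Mapping.single r (c * \<delta> e)"
    using span_relation[OF f g] by metis
  obtain s e' where s: "s \<in> relations C y z" and e': "epic C e'" "e' \<in> hom C v (Dom C (rel_rep s))"
    and hk: "h = Comp C (src_leg C y z s) e'" "k = Comp C (tgt_leg C y z s) e'"
    "\<And>c. span y z h k c = Poly_Mapping.single s (c * \<delta> e')"
    using span_relation[OF h k] by metis
  show ?thesis
    unfolding fg(3) hk(3) T0_comp_single[OF r s]
    unfolding fg(1,2) hk(1,2) span_comp_epi[OF legs_hom(1,2)[OF r] legs_hom(1,2)[OF s] e e']
    by (simp add: mult_ac)
qed

lemma T0_comp_zero [simp]: "LComp (T0 C \<delta>) x y z 0 a = 0" "LComp (T0 C \<delta>) x y z b 0 = 0"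
  by (simp_all add: T0_def)

lemma T0_comp_add:
  "LComp (T0 C \<delta>) x y z (b + b') a = LComp (T0 C \<delta>) x y z b a + LComp (T0 C \<delta>) x y z b' a"
  "LComp (T0 C \<delta>) x y z b (a + a') = LComp (T0 C \<delta>) x y z b a + LComp (T0 C \<delta>) x y z b a'"
proof -
  \<comment> \<open>The contribution of one pair of relations. It vanishes with either coefficient
    and is additive in each, so the sums over keys are additive even when cancellation removes
    keys.\<close>
  define B where "B r s c d = (if rel_pullback_exists C x y z r s
      then Poly_Mapping.single (rel_star C x y z r s) (d * c * \<delta> (rel_epi C x y z r s)) else 0)" for r s c d
  have L: "LComp (T0 C \<delta>) x y z b a = (\<Sum>r\<in>Poly_Mapping.keys a. \<Sum>s\<in>Poly_Mapping.keys b.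
      B r s (Poly_Mapping.lookup a r) (Poly_Mapping.lookup b s))" for a b
    by (simp add: T0_def B_def)
  have B: "B r s 0 d = 0" "B r s c 0 = 0" "B r s (c + c') d = B r s c d + B r s c' d"
    "B r s c (d + d') = B r s c d + B r s c d'" for r s c c' d d'
    by (simp_all add: B_def single_add distrib_left distrib_right)
  show "LComp (T0 C \<delta>) x y z (b + b') a = LComp (T0 C \<delta>) x y z b a + LComp (T0 C \<delta>) x y z b' a"
    unfolding L sum.distrib[symmetric]
    by (intro sum.cong refl setsum_keys_plus_distrib) (simp_all add: B)
  show "LComp (T0 C \<delta>) x y z b (a + a') = LComp (T0 C \<delta>) x y z b a + LComp (T0 C \<delta>) x y z b a'"
    unfolding L
    by (intro setsum_keys_plus_distrib) (simp_all add: B sum.distrib)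
qed

text \<open>Relations are spans and scalars are contained in the coefficient \<open>c\<close>, so
  additive properties need no separate case for scalar multiples.\<close>

lemma T0_induct [consumes 1, case_names zero span add]:
  assumes "Poly_Mapping.keys a \<subseteq> relations C x y"
    and "P 0"
    and "\<And>w f g c. f \<in> hom C w x \<Longrightarrow> g \<in> hom C w y \<Longrightarrow> P (span x y f g c)"
    and "\<And>a b. P a \<Longrightarrow> P b \<Longrightarrow> P (a + b)"
  shows "P a"
proof -
  have "P (\<Sum>r\<in>R. Poly_Mapping.single r (Poly_Mapping.lookup a r))"
    if "finite R" "R \<subseteq> relations C x y" for R
    using that
  proof (induction R rule: finite_induct)
    case (insert r R)
    then have "P (Poly_Mapping.single r (Poly_Mapping.lookup a r))"
      using assms(3)[OF legs_hom(1,2), of r] single_relation[of r x y] by simp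
    then show ?case using insert assms(4) by simp
  qed (simp add: assms(2))
  moreover have "(\<Sum>r\<in>Poly_Mapping.keys a. Poly_Mapping.single r (Poly_Mapping.lookup a r)) = a"
    by (rule poly_mapping_eqI)
      (auto simp: lookup_sum lookup_single when_def in_keys_iff)
  ultimately show ?thesis using assms(1) finite_keys[of a] by metis
qed

end

section \<open>Graphs, associativity and the linear category of relations\<close>

context graded_category begin

lemma keys_span_comp:
  assumes f: "f \<in> hom C w x" and g: "g \<in> hom C w y" and h: "h \<in> hom C v y" and k: "k \<in> hom C v z"
  shows "Poly_Mapping.keys (span_comp x z f g h k c) \<subseteq> relations C x z"
proof (cases "has_pullback C g h")
  case True
  then obtain p q where pq: "is_pullback C g h p q" by (auto simp: has_pullback_def)
  have p: "p \<in> hom C (Dom C p) w" by (rule is_pullback_dom[OF pq g])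
  show ?thesis
    unfolding span_comp_pullback[OF f g h k pq]
    by (rule keys_span[OF comp_hom[OF p f] comp_hom[OF is_pullback_square(1)[OF pq g h p] k]])
qed (simp add: span_comp_def)

text \<open>A cospan of \<open>g\<close> with an identity has a trivial pullback, so composing with
  a graph afterwards only changes the right leg.\<close>

lemma T0_comp_graph_left:
  assumes f: "f \<in> hom C w x" and g: "g \<in> hom C w y" and k: "k \<in> hom C y z"
  shows "LComp (T0 C \<delta>) x y z (span y z (Idt C y) k 1) (span x y f g c) = span x z f (Comp C k g) c"
  using T0_comp_span[OF f g idt_hom k] span_comp_pullback[OF f g idt_hom k is_pullback_idt[OF g]]
    hom_obj[OF g] comp_idt[OF f] by simp

text \<open>The graph comes first here, so \<open>h\<close> has to be pulled back along
  \<open>g\<close>. The pullback is left as a premise, to be supplied by a Cartesian naturality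
  square.\<close>

lemma T0_comp_graph_right:
  assumes g: "g \<in> hom C x y" and h: "h \<in> hom C v y" and k: "k \<in> hom C v z"
    and pq: "is_pullback C g h p q"
  shows "LComp (T0 C \<delta>) x y z (span y z h k c) (span x y (Idt C x) g 1) = span x z p (Comp C k q) c"
proof -
  have x: "Idt C x \<in> hom C x x" using hom_obj[OF g] idt_hom by blast
  have p: "p \<in> hom C (Dom C p) x" by (rule is_pullback_dom[OF pq g])
  show ?thesis
    using T0_comp_span[OF x g h k] span_comp_pullback[OF x g h k pq] idt_comp[OF p] by simp
qed

lemma T0_idt:
  assumes "x \<in> Obj C"
  shows "LIdt (T0 C \<delta>) x = span x x (Idt C x) (Idt C x) 1"
proof -
  note i = idt_hom[OF assms]
  have "jointly_monic (Idt C x) (Idt C x)"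
    by (rule is_pullback_jointly_monic[OF is_pullback_idt[OF i]])
  then show ?thesis using span_jointly_monic[OF i i] by (simp add: T0_def)
qed

text \<open>Both bracketings describe the span out of the triple pullback. The delicate point is
  that the two iterated pullbacks must exist or fail together.\<close>

lemma T0_assoc_span:
  assumes f: "f \<in> hom C w x" and g: "g \<in> hom C w y"
    and h: "h \<in> hom C w' y" and k: "k \<in> hom C w' z"
    and l: "l \<in> hom C w'' z" and m: "m \<in> hom C w'' t"
  shows "LComp (T0 C \<delta>) x z t (span z t l m c) (LComp (T0 C \<delta>) x y z (span y z h k b) (span x y f g a)) =
    LComp (T0 C \<delta>) x y t (LComp (T0 C \<delta>) y z t (span z t l m c) (span y z h k b)) (span x y f g a)"
    (is "?lhs = ?rhs")
proof -
  \<comment> \<open>\<open>?P\<close> and \<open>?Q\<close> say that the iterated pullback exists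
    for the left and for the right bracketing; when it does not, the corresponding side is
    zero.\<close>
  let ?P = "\<exists>p q u v. is_pullback C g h p q \<and> is_pullback C (Comp C k q) l u v"
  let ?Q = "\<exists>p q u v. is_pullback C k l p q \<and> is_pullback C g (Comp C h p) u v"
  have lhs_zero: "?lhs = 0" if "\<not> ?P"
  proof (cases "has_pullback C g h")
    case True
    then obtain p q where pq: "is_pullback C g h p q" by (auto simp: has_pullback_def)
    have p: "p \<in> hom C (Dom C p) w" by (rule is_pullback_dom[OF pq g])
    note q = is_pullback_square(1)[OF pq g h p]
    have "\<not> has_pullback C (Comp C k q) l" using that pq by (auto simp: has_pullback_def)
    then show ?thesis
      unfolding T0_comp_span[OF f g h k] span_comp_pullback[OF f g h k pq]
        T0_comp_span[OF comp_hom[OF p f] comp_hom[OF q k] l m] by (simp add: span_comp_def)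
  qed (simp add: T0_comp_span[OF f g h k] span_comp_def)
  have rhs_zero: "?rhs = 0" if "\<not> ?Q"
  proof (cases "has_pullback C k l")
    case True
    then obtain p q where pq: "is_pullback C k l p q" by (auto simp: has_pullback_def)
    have p: "p \<in> hom C (Dom C p) w'" by (rule is_pullback_dom[OF pq k])
    note q = is_pullback_square(1)[OF pq k l p]
    have "\<not> has_pullback C g (Comp C h p)" using that pq by (auto simp: has_pullback_def)
    then show ?thesis
      unfolding T0_comp_span[OF h k l m] span_comp_pullback[OF h k l m pq]
        T0_comp_span[OF f g comp_hom[OF p h] comp_hom[OF q m]] by (simp add: span_comp_def)
  qed (simp add: T0_comp_span[OF h k l m] span_comp_def)
  \<comment> \<open>The projections from the right-hand triple pullback complete the cospans of the
    other bracketing to commutative squares, and \<open>pullback_exists\<close> produces the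
    pullbacks.\<close>
  have QP: ?P if Q: ?Q
  proof -
    obtain p q u v where pq: "is_pullback C k l p q" and uv: "is_pullback C g (Comp C h p) u v"
      using Q by blast
    have p: "p \<in> hom C (Dom C p) w'" by (rule is_pullback_dom[OF pq k])
    note q = is_pullback_square[OF pq k l p] and hp = comp_hom[OF p h]
    have u: "u \<in> hom C (Dom C u) w" by (rule is_pullback_dom[OF uv g])
    note v = is_pullback_square[OF uv g hp u]
    have sq: "Comp C g u = Comp C h (Comp C p v)" using v(2) comp_assoc[OF v(1) p h] by simp
    have "has_pullback C g h"
      by (rule pullback_exists[OF comm_squareI[OF g h u comp_hom[OF v(1) p] sq]])
    then obtain p' q' where pq': "is_pullback C g h p' q'" by (auto simp: has_pullback_def)
    have p': "p' \<in> hom C (Dom C p') w" by (rule is_pullback_dom[OF pq' g])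
    note q' = is_pullback_square(1)[OF pq' g h p']
    obtain n where n: "n \<in> hom C (Dom C u) (Dom C p')" "Comp C q' n = Comp C p v"
      using is_pullback_univ[OF pq' g h p' u comp_hom[OF v(1) p] sq] by blast
    have "Comp C (Comp C k q') n = Comp C l (Comp C q v)"
      using comp_assoc[OF n(1) q' k] n(2) comp_assoc[OF v(1) p k] q(2) comp_assoc[OF v(1) q(1) l] by simp
    then have "has_pullback C (Comp C k q') l"
      by (rule pullback_exists[OF comm_squareI[OF comp_hom[OF q' k] l n(1) comp_hom[OF v(1) q(1)]]])
    then show ?P using pq' by (auto simp: has_pullback_def)
  qed
  show ?thesis
  proof (cases ?P)
    case False
    then have "\<not> ?Q" using QP by blast
    then show ?thesis using lhs_zero[OF False] rhs_zero by simp
  next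
    case True
    then obtain p q u v where pq: "is_pullback C g h p q" and uv: "is_pullback C (Comp C k q) l u v" by blast
    have p: "p \<in> hom C (Dom C p) w" by (rule is_pullback_dom[OF pq g])
    note q = is_pullback_square[OF pq g h p] and kq = comp_hom[OF is_pullback_square(1)[OF pq g h p] k]
    have u: "u \<in> hom C (Dom C u) (Dom C p)" by (rule is_pullback_dom[OF uv kq])
    note v = is_pullback_square[OF uv kq l u]
    have sq: "Comp C k (Comp C q u) = Comp C l v" using v(2) comp_assoc[OF u q(1) k] by simp
    have "has_pullback C k l"
      by (rule pullback_exists[OF comm_squareI[OF k l comp_hom[OF u q(1)] v(1) sq]])
    then obtain p' q' where pq': "is_pullback C k l p' q'" by (auto simp: has_pullback_def)
    have p': "p' \<in> hom C (Dom C p') w'" by (rule is_pullback_dom[OF pq' k])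
    note q' = is_pullback_square(1)[OF pq' k l p']
    \<comment> \<open>\<open>n\<close> compares the left-hand triple pullback with the pullback of
      \<open>k\<close> and \<open>l\<close>. Cancelling one pullback square against the other makes
      it a projection of the right-hand triple pullback, so both sides have the same apex.\<close>
    obtain n where n: "n \<in> hom C (Dom C u) (Dom C p')" "Comp C p' n = Comp C q u" "Comp C q' n = v"
      using is_pullback_univ[OF pq' k l p' comp_hom[OF u q(1)] v(1) sq] by blast
    have "is_pullback C p' q n u"
      by (rule is_pullback_cancel[OF is_pullback_sym[OF pq'] is_pullback_sym[OF uv] q(1) k n(1) q' n(3,2)])
    then have pb: "is_pullback C g (Comp C h p') (Comp C p u) n"
      by (rule is_pullback_paste[OF pq is_pullback_sym])
    have "?lhs = span x t (Comp C (Comp C f p) u) (Comp C m v) (a * b * c)"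
      unfolding T0_comp_span[OF f g h k] span_comp_pullback[OF f g h k pq]
        T0_comp_span[OF comp_hom[OF p f] kq l m] span_comp_pullback[OF comp_hom[OF p f] kq l m uv] ..
    moreover have "?rhs = span x t (Comp C f (Comp C p u)) (Comp C (Comp C m q') n) (a * (b * c))"
      unfolding T0_comp_span[OF h k l m] span_comp_pullback[OF h k l m pq']
        T0_comp_span[OF f g comp_hom[OF p' h] comp_hom[OF q' m]]
        span_comp_pullback[OF f g comp_hom[OF p' h] comp_hom[OF q' m] pb] ..
    ultimately show ?thesis
      using comp_assoc[OF u p f] comp_assoc[OF n(1) q' m] n(3) by (simp add: mult.assoc)
  qed
qed

lemma T0_linear_category: "linear_category (T0 C \<delta>)"
proof
  fix x y f g assume "f \<in> LHom (T0 C \<delta>) x y" "g \<in> LHom (T0 C \<delta>) x y"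
  then show "f + g \<in> LHom (T0 C \<delta>) x y" using keys_add[of f g] by auto
next
  fix x assume "x \<in> LObj (T0 C \<delta>)"
  then show "LIdt (T0 C \<delta>) x \<in> LHom (T0 C \<delta>) x x"
    using keys_span[OF idt_hom idt_hom] by (simp add: T0_idt)
next
  fix x y z f g assume "f \<in> LHom (T0 C \<delta>) x y" "g \<in> LHom (T0 C \<delta>) y z"
  then have fg: "Poly_Mapping.keys f \<subseteq> relations C x y" "Poly_Mapping.keys g \<subseteq> relations C y z" by simp_all
  have add: "Poly_Mapping.keys (a + b) \<subseteq> relations C x z"
    if "Poly_Mapping.keys a \<subseteq> relations C x z" "Poly_Mapping.keys b \<subseteq> relations C x z" for a b :: "'a set \<Rightarrow>\<^sub>0 'k"
    using that keys_add[of a b] by blast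
  from fg(1) have "Poly_Mapping.keys (LComp (T0 C \<delta>) x y z g f) \<subseteq> relations C x z"
  proof (induction rule: T0_induct)
    case f: (span w f f' c)
    from fg(2) show ?case
    proof (induction rule: T0_induct)
      case g: (span v g g' d)
      show ?case unfolding T0_comp_span[OF f g] by (rule keys_span_comp[OF f g])
    qed (simp_all add: T0_comp_add add)
  qed (simp_all add: T0_comp_add add)
  then show "LComp (T0 C \<delta>) x y z g f \<in> LHom (T0 C \<delta>) x z" by simp
next
  fix x y f assume x: "x \<in> LObj (T0 C \<delta>)" and y: "y \<in> LObj (T0 C \<delta>)" and "f \<in> LHom (T0 C \<delta>) x y"
  then have f: "Poly_Mapping.keys f \<subseteq> relations C x y" by simp
  from f show "LComp (T0 C \<delta>) x x y f (LIdt (T0 C \<delta>) x) = f"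
  proof (induction rule: T0_induct)
    case (span w f g c)
    then show ?case
      using T0_comp_graph_right[OF idt_hom span is_pullback_sym[OF is_pullback_idt[OF span(1)]]] x T0_idt[of x]
        comp_idt[OF span(2)] by simp
  qed (simp_all add: T0_comp_add)
  from f show "LComp (T0 C \<delta>) x y y (LIdt (T0 C \<delta>) y) f = f"
  proof (induction rule: T0_induct)
    case (span w f g c)
    then show ?case
      using T0_comp_graph_left[OF span idt_hom] y T0_idt[of y] idt_comp[OF span(2)] by simp
  qed (simp_all add: T0_comp_add)
next
  fix w x y z f g h
  assume "f \<in> LHom (T0 C \<delta>) w x" "g \<in> LHom (T0 C \<delta>) x y" "h \<in> LHom (T0 C \<delta>) y z"
  then have fgh: "Poly_Mapping.keys f \<subseteq> relations C w x" "Poly_Mapping.keys g \<subseteq> relations C x y"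
    "Poly_Mapping.keys h \<subseteq> relations C y z" by simp_all
  from fgh(1) show "LComp (T0 C \<delta>) w y z h (LComp (T0 C \<delta>) w x y g f) =
      LComp (T0 C \<delta>) w x z (LComp (T0 C \<delta>) x y z h g) f"
  proof (induction rule: T0_induct)
    case f: (span _ f f' a)
    from fgh(2) show ?case
    proof (induction rule: T0_induct)
      case g: (span _ g g' b)
      from fgh(3) show ?case
      proof (induction rule: T0_induct)
        case h: (span _ h h' c)
        show ?case by (rule T0_assoc_span[OF f g h])
      qed (simp_all add: T0_comp_add)
    qed (simp_all add: T0_comp_add)
  qed (simp_all add: T0_comp_add)
qed (simp_all add: T0_comp_add)

end

section \<open>Induced functors and adjunctions\<close>

locale graded_functor = dom: graded_category C \<delta> + cod: graded_category D \<delta>' + cfunctor C D F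
  for C :: "('o, 'a) cat" and \<delta> :: "'a \<Rightarrow> 'k::field" and D :: "('p, 'b) cat" and \<delta>' :: "'b \<Rightarrow> 'k"
    and F :: "('o, 'a, 'p, 'b) ftor" +
  assumes degree: "preserves_degree C \<delta> D \<delta>' F"
    and pullbacks: "preserves_pullbacks C D F"
begin

lemma map_pullback:
  "is_pullback C f g p q \<Longrightarrow> is_pullback D (on_arr F f) (on_arr F g) (on_arr F p) (on_arr F q)"
  using pullbacks by (auto simp: preserves_pullbacks_def)

lemma map_has_pullback_iff:
  assumes "f \<in> hom C x z" "g \<in> hom C y z"
  shows "has_pullback D (on_arr F f) (on_arr F g) \<longleftrightarrow> has_pullback C f g"
proof
  show "has_pullback C f g" if "has_pullback D (on_arr F f) (on_arr F g)"
    using that pullbacks homD[OF assms(1)] homD[OF assms(2)] by (simp add: preserves_pullbacks_def)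
  show "has_pullback D (on_arr F f) (on_arr F g)" if "has_pullback C f g"
    using that map_pullback unfolding has_pullback_def by blast
qed

lemma map_epic:
  assumes "epic C e" shows "epic D (on_arr F e)" "\<delta>' (on_arr F e) = \<delta> e"
  using degree assms by (auto simp: preserves_degree_def)

lemma map_monic:
  assumes "monic C m" "m \<in> hom C x y" shows "monic D (on_arr F m)"
proof -
  have "is_pullback D (on_arr F m) (on_arr F m) (on_arr F (Idt C x)) (on_arr F (Idt C x))"
    using assms dom.monic_iff_pullback by (intro map_pullback) simp
  then show ?thesis
    using cod.monic_iff_pullback[OF map_hom[OF assms(2)]] map_idt dom.hom_obj(1)[OF assms(2)] by simp
qed

text \<open>\<open>f\<close> and \<open>g\<close> are the two projections of a product after one
  monomorphism. \<open>F\<close> keeps that monomorphism monic, and it keeps the projections jointly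
  monic because they are the legs of a pullback.\<close>

lemma map_jointly_monic:
  assumes f: "f \<in> hom C w x" and g: "g \<in> hom C w y" and "dom.jointly_monic f g"
  shows "cod.jointly_monic (on_arr F f) (on_arr F g)"
  unfolding cod.jointly_monic_def homD(2)[OF map_hom[OF f]]
proof (intro allI ballI impI)
  note P = dom.has_product_span[OF f g]
  note p = dom.product_homs(1,2)[OF P] and m = dom.pairing[OF P f g]
  have "monic C (pairing C x y f g)" using dom.monic_pairing_iff[OF P f g] assms(3) by simp
  then have monic: "monic D (on_arr F (pairing C x y f g))" using m(1) by (rule map_monic)
  obtain t where t: "terminal C t" using dom.terminal_exists by blast
  obtain a where a: "a \<in> hom C x t" using t dom.hom_obj(2)[OF f] by (auto simp: terminal_def)
  obtain b where b: "b \<in> hom C y t" using t dom.hom_obj(2)[OF g] by (auto simp: terminal_def)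
  \<comment> \<open>The image square is a pullback over \<open>F t\<close>, which need not be
    terminal; joint monicity of its legs holds all the same.\<close>
  have jm: "cod.jointly_monic (on_arr F (pr1 C x y)) (on_arr F (pr2 C x y))"
    by (rule cod.is_pullback_jointly_monic[OF map_pullback[OF dom.product_pullback[OF P t a b]]])
  fix v u u'
  assume u: "u \<in> hom D v (on_obj F w)" "u' \<in> hom D v (on_obj F w)"
    and eq: "Comp D (on_arr F f) u = Comp D (on_arr F f) u'" "Comp D (on_arr F g) u = Comp D (on_arr F g) u'"
  have f_eq: "on_arr F f = Comp D (on_arr F (pr1 C x y)) (on_arr F (pairing C x y f g))"
    using map_comp[OF m(1) p(1)] m(2) by simp
  have g_eq: "on_arr F g = Comp D (on_arr F (pr2 C x y)) (on_arr F (pairing C x y f g))"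
    using map_comp[OF m(1) p(2)] m(3) by simp
  note Fm = map_hom[OF m(1)] and Fp = map_hom[OF p(1)] map_hom[OF p(2)]
  have "Comp D (on_arr F (pairing C x y f g)) u = Comp D (on_arr F (pairing C x y f g)) u'"
  proof (rule cod.jointly_monicD[OF jm Fp(1) cod.comp_hom[OF u(1) Fm] cod.comp_hom[OF u(2) Fm]])
    show "Comp D (on_arr F (pr1 C x y)) (Comp D (on_arr F (pairing C x y f g)) u) =
        Comp D (on_arr F (pr1 C x y)) (Comp D (on_arr F (pairing C x y f g)) u')"
      using eq(1) unfolding f_eq cod.comp_assoc[OF u(1) Fm Fp(1)] cod.comp_assoc[OF u(2) Fm Fp(1)] .
    show "Comp D (on_arr F (pr2 C x y)) (Comp D (on_arr F (pairing C x y f g)) u) =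
        Comp D (on_arr F (pr2 C x y)) (Comp D (on_arr F (pairing C x y f g)) u')"
      using eq(2) unfolding g_eq cod.comp_assoc[OF u(1) Fm Fp(2)] cod.comp_assoc[OF u(2) Fm Fp(2)] .
  qed
  then show "u = u'" by (rule cod.monicD[OF monic Fm u])
qed

lemma T0_map_zero [simp]: "T0_map C D F x y 0 = 0"
  by (simp add: T0_map_def)

lemma T0_map_add: "T0_map C D F x y (a + b) = T0_map C D F x y a + T0_map C D F x y b"
  unfolding T0_map_def by (rule setsum_keys_plus_distrib) (simp_all add: single_add)

text \<open>Composing the comparison from \<open>F (x * y)\<close> to the product of
  \<open>F x\<close> and \<open>F y\<close> with the image of the representative gives the pairing
  of the images of the legs. This pairing is monic, so it is its own image and the scalar
  \<open>c\<close> is unchanged.\<close>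

lemma T0_map_single:
  assumes "r \<in> relations C x y"
  shows "T0_map C D F x y (Poly_Mapping.single r c) = cod.span (on_obj F x) (on_obj F y)
    (on_arr F (src_leg C x y r)) (on_arr F (tgt_leg C x y r)) c"
proof -
  note r = dom.relationsD[OF assms] and l = dom.legs_hom[OF assms]
  note p = dom.product_homs(1,2)[OF r(1)]
  note Fp = map_hom[OF p(1)] map_hom[OF p(2)] and Fl = map_hom[OF l(1)] map_hom[OF l(2)]
  have "Comp D (pairing D (on_obj F x) (on_obj F y) (on_arr F (pr1 C x y)) (on_arr F (pr2 C x y)))
      (on_arr F (rel_rep r)) =
      pairing D (on_obj F x) (on_obj F y) (on_arr F (src_leg C x y r)) (on_arr F (tgt_leg C x y r))"
    using cod.pairing_comp[OF cod.has_product_span[OF Fp] Fp map_hom[OF r(3)]]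
      map_comp[OF r(3) p(1)] map_comp[OF r(3) p(2)] by (simp add: src_leg_def tgt_leg_def)
  then show ?thesis
    using cod.span_jointly_monic[OF Fl map_jointly_monic[OF l(1,2) dom.legs_jointly_monic[OF assms]]]
    by (simp add: T0_map_def rel_image_def)
qed

text \<open>Preservation of degrees enters here: the image epimorphism of the span goes to an
  epimorphism of the same degree, so the weight of the span is respected.\<close>

lemma T0_map_span:
  assumes f: "f \<in> hom C w x" and g: "g \<in> hom C w y"
  shows "T0_map C D F x y (dom.span x y f g c) =
    cod.span (on_obj F x) (on_obj F y) (on_arr F f) (on_arr F g) c"
proof (rule dom.span_relation[OF f g])
  fix r e assume r: "r \<in> relations C x y" and e: "epic C e" "e \<in> hom C w (Dom C (rel_rep r))"
    and fg: "f = Comp C (src_leg C x y r) e" "g = Comp C (tgt_leg C x y r) e"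
    and s: "\<And>c. dom.span x y f g c = Poly_Mapping.single r (c * \<delta> e)"
  note l = dom.legs_hom(1,2)[OF r]
  show ?thesis
    unfolding s T0_map_single[OF r]
    unfolding fg map_comp[OF e(2) l(1)] map_comp[OF e(2) l(2)]
      cod.span_precomp_epi[OF map_hom[OF l(1)] map_hom[OF l(2)] map_epic(1)[OF e(1)] map_hom[OF e(2)]]
    by (simp add: map_epic(2)[OF e(1)])
qed

lemma T0_map_span_comp:
  assumes f: "f \<in> hom C w x" and g: "g \<in> hom C w y" and h: "h \<in> hom C v y" and k: "k \<in> hom C v z"
  shows "T0_map C D F x z (dom.span_comp x z f g h k c) = cod.span_comp (on_obj F x) (on_obj F z)
    (on_arr F f) (on_arr F g) (on_arr F h) (on_arr F k) c"
proof (cases "has_pullback C g h")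
  case True
  then obtain p q where pq: "is_pullback C g h p q" by (auto simp: has_pullback_def)
  have p: "p \<in> hom C (Dom C p) w" by (rule dom.is_pullback_dom[OF pq g])
  note q = dom.is_pullback_square(1)[OF pq g h p]
  show ?thesis
    unfolding dom.span_comp_pullback[OF f g h k pq] T0_map_span[OF dom.comp_hom[OF p f] dom.comp_hom[OF q k]]
      map_comp[OF p f] map_comp[OF q k]
      cod.span_comp_pullback[OF map_hom[OF f] map_hom[OF g] map_hom[OF h] map_hom[OF k] map_pullback[OF pq]] ..
next
  case False
  \<comment> \<open>Both composites are zero, because the existence of pullbacks is also reflected
    by \<open>F\<close>.\<close>
  then show ?thesis
    using map_has_pullback_iff[OF g h] by (simp add: dom.span_comp_def cod.span_comp_def)
qed

lemma T0_linear_functor: "linear_functor (T0 C \<delta>) (T0 D \<delta>') (on_obj F) (T0_map C D F)"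
proof (intro linear_functor.intro linear_functor_axioms.intro)
  show "linear_category (T0 C \<delta>)" by (rule dom.T0_linear_category)
  show "linear_category (T0 D \<delta>')" by (rule cod.T0_linear_category)
  show "on_obj F x \<in> LObj (T0 D \<delta>')" if "x \<in> LObj (T0 C \<delta>)" for x using that map_obj by simp
  show "T0_map C D F x y 0 = 0" for x y by simp
  show "T0_map C D F x y (f + g) = T0_map C D F x y f + T0_map C D F x y g" for x y f g
    by (rule T0_map_add)
next
  fix x assume "x \<in> LObj (T0 C \<delta>)"
  then have x: "x \<in> Obj C" by simp
  show "T0_map C D F x x (LIdt (T0 C \<delta>) x) = LIdt (T0 D \<delta>') (on_obj F x)"
    using T0_map_span[OF dom.idt_hom dom.idt_hom] x map_obj[OF x]
    by (simp add: dom.T0_idt cod.T0_idt map_idt)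
next
  fix x y f assume "f \<in> LHom (T0 C \<delta>) x y"
  then have "Poly_Mapping.keys f \<subseteq> relations C x y" by simp
  then have "Poly_Mapping.keys (T0_map C D F x y f) \<subseteq> relations D (on_obj F x) (on_obj F y)"
  proof (induction rule: dom.T0_induct)
    case (span w f g c)
    show ?case unfolding T0_map_span[OF span] by (rule cod.keys_span[OF map_hom[OF span(1)] map_hom[OF span(2)]])
  next
    case (add a b)
    then show ?case unfolding T0_map_add
      using keys_add[of "T0_map C D F x y a" "T0_map C D F x y b"] by blast
  qed simp
  then show "T0_map C D F x y f \<in> LHom (T0 D \<delta>') (on_obj F x) (on_obj F y)" by simp
next
  fix x y z f g assume "f \<in> LHom (T0 C \<delta>) x y" "g \<in> LHom (T0 C \<delta>) y z"
  then have fg: "Poly_Mapping.keys f \<subseteq> relations C x y" "Poly_Mapping.keys g \<subseteq> relations C y z" by simp_all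
  from fg(1) show "T0_map C D F x z (LComp (T0 C \<delta>) x y z g f) =
      LComp (T0 D \<delta>') (on_obj F x) (on_obj F y) (on_obj F z) (T0_map C D F y z g) (T0_map C D F x y f)"
  proof (induction rule: dom.T0_induct)
    case f: (span w f f' c)
    from fg(2) show ?case
    proof (induction rule: dom.T0_induct)
      case g: (span v g g' d)
      show ?case
        unfolding dom.T0_comp_span[OF f g] T0_map_span_comp[OF f g] T0_map_span[OF f] T0_map_span[OF g]
          cod.T0_comp_span[OF map_hom[OF f(1)] map_hom[OF f(2)] map_hom[OF g(1)] map_hom[OF g(2)]] ..
    qed (simp_all add: dom.T0_comp_add cod.T0_comp_add T0_map_add)
  qed (simp_all add: dom.T0_comp_add cod.T0_comp_add T0_map_add)
qed

end

section \<open>Pullbacks under a right adjoint\<close>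

lemma (in adjunction) right_preserves_pullbacks:
  assumes "regular_category C" shows "preserves_pullbacks C D F"
  unfolding preserves_pullbacks_def
proof (intro conjI allI impI ballI)
  fix f g p q assume pq: "is_pullback C f g p q"
  obtain w x y z where f: "f \<in> hom C x z" and g: "g \<in> hom C y z" and p: "p \<in> hom C w x"
    and q: "q \<in> hom C w y" and sq: "Comp C f p = Comp C g q"
    by (rule right.dom.is_pullback_homE[OF pq])
  note o = right.dom.hom_obj
  show "is_pullback D (on_arr F f) (on_arr F g) (on_arr F p) (on_arr F q)"
  proof (rule right.cod.is_pullbackI[OF right.map_hom[OF f] right.map_hom[OF g] right.map_hom[OF p] right.map_hom[OF q]])
    show "Comp D (on_arr F f) (on_arr F p) = Comp D (on_arr F g) (on_arr F q)"
      using right.map_comp[OF p f] right.map_comp[OF q g] sq by simp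
  next
    fix v p' q' assume p': "p' \<in> hom D v (on_obj F x)" and q': "q' \<in> hom D v (on_obj F y)"
      and eq: "Comp D (on_arr F f) p' = Comp D (on_arr F g) q'"
    have v: "v \<in> Obj D" by (rule right.cod.hom_obj[OF p'])
    have "Comp C f (transpose x p') = Comp C g (transpose y q')"
      using comp_transpose[OF f p'] comp_transpose[OF g q'] eq by simp
    then obtain u where u: "u \<in> hom C (on_obj G v) w" "Comp C p u = transpose x p'" "Comp C q u = transpose y q'"
      using right.dom.is_pullback_univ[OF pq f g p transpose_hom[OF o(1)[OF f] p'] transpose_hom[OF o(1)[OF g] q']]
      by blast
    \<comment> \<open>The mediating arrow in \<open>D\<close> is the mediating arrow
      \<open>u\<close> of the transposed square, carried back through \<open>\<eta>\<close>.\<close>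
    show "\<exists>u\<in>hom D v (on_obj F w). Comp D (on_arr F p) u = p' \<and> Comp D (on_arr F q) u = q'"
    proof (intro bexI conjI)
      show "Comp D (on_arr F u) (\<eta> v) \<in> hom D v (on_obj F w)" by (rule untranspose_hom[OF v u(1)])
      show "Comp D (on_arr F p) (Comp D (on_arr F u) (\<eta> v)) = p'"
        unfolding comp_untranspose[OF v u(1) p] u(2) by (rule untranspose_transpose[OF o(1)[OF f] p'])
      show "Comp D (on_arr F q) (Comp D (on_arr F u) (\<eta> v)) = q'"
        unfolding comp_untranspose[OF v u(1) q] u(3) by (rule untranspose_transpose[OF o(1)[OF g] q'])
    qed
  next
    fix v u u' assume u: "u \<in> hom D v (on_obj F w)" "u' \<in> hom D v (on_obj F w)"
      "Comp D (on_arr F p) u = Comp D (on_arr F p) u'" "Comp D (on_arr F q) u = Comp D (on_arr F q) u'"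
    note w = o(1)[OF p]
    have "transpose w u = transpose w u'"
    proof (rule right.dom.is_pullback_uniq[OF pq f g p transpose_hom[OF w u(1)] transpose_hom[OF w u(2)]])
      show "Comp C p (transpose w u) = Comp C p (transpose w u')"
        unfolding comp_transpose[OF p u(1)] comp_transpose[OF p u(2)] u(3) ..
      show "Comp C q (transpose w u) = Comp C q (transpose w u')"
        unfolding comp_transpose[OF q u(1)] comp_transpose[OF q u(2)] u(4) ..
    qed
    then show "u = u'" using untranspose_transpose[OF w u(1)] untranspose_transpose[OF w u(2)] by metis
  qed
next
  fix f g assume fg: "f \<in> Arr C" "g \<in> Arr C" "Cod C f = Cod C g" and "has_pullback D (on_arr F f) (on_arr F g)"
  then obtain p q where pq: "is_pullback D (on_arr F f) (on_arr F g) p q" by (auto simp: has_pullback_def)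
  have f: "f \<in> hom C (Dom C f) (Cod C g)" and g: "g \<in> hom C (Dom C g) (Cod C g)" using fg by (auto simp: hom_def)
  note Ff = right.map_hom[OF f] and Fg = right.map_hom[OF g]
  have p: "p \<in> hom D (Dom D p) (on_obj F (Dom C f))" by (rule right.cod.is_pullback_dom[OF pq Ff])
  note q = right.cod.is_pullback_square[OF pq Ff Fg p] and o = right.dom.hom_obj(1)
  \<comment> \<open>Regularity of \<open>C\<close> is what makes this square sufficient: one
    commutative completion of the cospan guarantees its pullback.\<close>
  have "Comp C f (transpose (Dom C f) p) = Comp C g (transpose (Dom C g) q)"
    using comp_transpose[OF f p] comp_transpose[OF g q(1)] q(2) by simp
  then show "has_pullback C f g"
    by (rule regular_category.pullback_exists[OF assms right.dom.comm_squareI[OF f g transpose_hom[OF o[OF f] p] transpose_hom[OF o[OF g] q(1)]]])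
qed

section \<open>The adjunction between the categories of relations\<close>

locale graded_adjunction = adjunction C D F G \<eta> \<epsilon> + right: graded_functor C \<delta> D \<delta>' F + left: graded_functor D \<delta>' C \<delta> G
  for C :: "('o, 'a) cat" and \<delta> :: "'a \<Rightarrow> 'k::field" and D :: "('p, 'b) cat" and \<delta>' :: "'b \<Rightarrow> 'k"
    and F :: "('o, 'a, 'p, 'b) ftor" and G :: "('p, 'b, 'o, 'a) ftor"
    and \<eta> :: "'p \<Rightarrow> 'b" and \<epsilon> :: "'o \<Rightarrow> 'a" +
  assumes unit_cartesian: "f' \<in> hom D x' y' \<Longrightarrow> is_pullback D (\<eta> y') (on_arr F (on_arr G f')) f' (\<eta> x')"
    and counit_cartesian: "f \<in> hom C x y \<Longrightarrow> is_pullback C (\<epsilon> y) f (on_arr G (on_arr F f)) (\<epsilon> x)"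
begin

text \<open>Graphs compose like the arrows themselves, which settles the triangle identities.
  Naturality is compared leg by leg on a span: the Cartesian square determines the left leg, and
  ordinary naturality of \<open>\<eta>\<close> or \<open>\<epsilon>\<close> the right one.\<close>

lemma T0_linear_adjunction:
  "linear_adjunction (T0 C \<delta>) (T0 D \<delta>') (on_obj F) (T0_map C D F) (on_obj G) (T0_map D C G)
    (\<lambda>x. right.cod.span x (on_obj F (on_obj G x)) (Idt D x) (\<eta> x) 1)
    (\<lambda>x. right.dom.span (on_obj G (on_obj F x)) x (Idt C (on_obj G (on_obj F x))) (\<epsilon> x) 1)"
proof (intro linear_adjunction.intro linear_adjunction_axioms.intro)
  show "linear_functor (T0 C \<delta>) (T0 D \<delta>') (on_obj F) (T0_map C D F)" by (rule right.T0_linear_functor)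
  show "linear_functor (T0 D \<delta>') (T0 C \<delta>) (on_obj G) (T0_map D C G)" by (rule left.T0_linear_functor)
next
  fix x assume "x \<in> LObj (T0 D \<delta>')"
  then have x: "x \<in> Obj D" by simp
  note i = right.cod.idt_hom[OF x] and h = unit_hom[OF x] and Gx = left.map_obj[OF x]
  show "right.cod.span x (on_obj F (on_obj G x)) (Idt D x) (\<eta> x) 1 \<in> LHom (T0 D \<delta>') x (on_obj F (on_obj G x))"
    using right.cod.keys_span[OF i h] by simp
  show "LComp (T0 C \<delta>) (on_obj G x) (on_obj G (on_obj F (on_obj G x))) (on_obj G x)
      (right.dom.span (on_obj G (on_obj F (on_obj G x))) (on_obj G x) 
        (Idt C (on_obj G (on_obj F (on_obj G x)))) (\<epsilon> (on_obj G x)) 1)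
      (T0_map D C G x (on_obj F (on_obj G x)) (right.cod.span x (on_obj F (on_obj G x)) (Idt D x) (\<eta> x) 1)) =
      LIdt (T0 C \<delta>) (on_obj G x)"
    unfolding left.T0_map_span[OF i h]
      right.dom.T0_comp_graph_left[OF left.map_hom[OF i] left.map_hom[OF h] counit_hom[OF Gx]]
    by (simp add: triangle_left[OF x] left.map_idt[OF x] right.dom.T0_idt[OF Gx])
next
  fix x assume "x \<in> LObj (T0 C \<delta>)"
  then have x: "x \<in> Obj C" by simp
  note Fx = right.map_obj[OF x]
  note i = right.dom.idt_hom[OF left.map_obj[OF Fx]] and h = counit_hom[OF x]
  note i' = right.cod.idt_hom[OF Fx] and h' = unit_hom[OF Fx]
  show "right.dom.span (on_obj G (on_obj F x)) x (Idt C (on_obj G (on_obj F x))) (\<epsilon> x) 1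
      \<in> LHom (T0 C \<delta>) (on_obj G (on_obj F x)) x"
    using right.dom.keys_span[OF i h] by simp
  show "LComp (T0 D \<delta>') (on_obj F x) (on_obj F (on_obj G (on_obj F x))) (on_obj F x)
      (T0_map C D F (on_obj G (on_obj F x)) x
        (right.dom.span (on_obj G (on_obj F x)) x (Idt C (on_obj G (on_obj F x))) (\<epsilon> x) 1))
      (right.cod.span (on_obj F x) (on_obj F (on_obj G (on_obj F x))) (Idt D (on_obj F x)) (\<eta> (on_obj F x)) 1) =
      LIdt (T0 D \<delta>') (on_obj F x)"
    unfolding right.T0_map_span[OF i h] right.map_idt[OF left.map_obj[OF Fx]]
      right.cod.T0_comp_graph_left[OF i' h' right.map_hom[OF h]]
    by (simp add: triangle_right[OF x] right.cod.T0_idt[OF Fx])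
next
  fix x y f assume "x \<in> LObj (T0 D \<delta>')" "y \<in> LObj (T0 D \<delta>')" "f \<in> LHom (T0 D \<delta>') x y"
  then have x: "x \<in> Obj D" and y: "y \<in> Obj D" and f: "Poly_Mapping.keys f \<subseteq> relations D x y" by simp_all
  from f show "LComp (T0 D \<delta>') x y (on_obj F (on_obj G y))
      (right.cod.span y (on_obj F (on_obj G y)) (Idt D y) (\<eta> y) 1) f =
      LComp (T0 D \<delta>') x (on_obj F (on_obj G x)) (on_obj F (on_obj G y))
      (T0_map C D F (on_obj G x) (on_obj G y) (T0_map D C G x y f))
      (right.cod.span x (on_obj F (on_obj G x)) (Idt D x) (\<eta> x) 1)"
  proof (induction rule: right.cod.T0_induct)
    case (span w f g c)
    \<comment> \<open>With the graph of the unit composed first, \<open>FG f\<close> has to be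
      pulled back along \<open>\<eta> x\<close>. By \<open>unit_cartesian\<close> the legs of this
      pullback are \<open>f\<close> and \<open>\<eta> w\<close>.\<close>
    note Gf = left.map_hom[OF span(1)] and Gg = left.map_hom[OF span(2)]
    show ?case
      unfolding right.cod.T0_comp_graph_left[OF span unit_hom[OF y]] left.T0_map_span[OF span]
        right.T0_map_span[OF Gf Gg]
        right.cod.T0_comp_graph_right[OF unit_hom[OF x] right.map_hom[OF Gf] right.map_hom[OF Gg] 
          unit_cartesian[OF span(1)]] unit_nat[OF span(2)] ..
  qed (simp_all add: right.cod.T0_comp_add right.T0_map_add left.T0_map_add)
next
  fix x y f assume "x \<in> LObj (T0 C \<delta>)" "y \<in> LObj (T0 C \<delta>)" "f \<in> LHom (T0 C \<delta>) x y"
  then have x: "x \<in> Obj C" and y: "y \<in> Obj C" and f: "Poly_Mapping.keys f \<subseteq> relations C x y" by simp_all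
  from f show "LComp (T0 C \<delta>) (on_obj G (on_obj F x)) (on_obj G (on_obj F y)) y
      (right.dom.span (on_obj G (on_obj F y)) y (Idt C (on_obj G (on_obj F y))) (\<epsilon> y) 1)
      (T0_map D C G (on_obj F x) (on_obj F y) (T0_map C D F x y f)) =
      LComp (T0 C \<delta>) (on_obj G (on_obj F x)) x y f
      (right.dom.span (on_obj G (on_obj F x)) x (Idt C (on_obj G (on_obj F x))) (\<epsilon> x) 1)"
  proof (induction rule: right.dom.T0_induct)
    case (span w f g c)
    \<comment> \<open>The graph of \<open>\<epsilon> x\<close> is now composed first on the
      right-hand side. By \<open>counit_cartesian\<close> pulling \<open>f\<close> back along
      \<open>\<epsilon> x\<close> gives \<open>GF f\<close>, which is already the left leg of the
      other composite.\<close>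
    note Ff = right.map_hom[OF span(1)] and Fg = right.map_hom[OF span(2)]
    show ?case
      unfolding right.T0_map_span[OF span] left.T0_map_span[OF Ff Fg]
        right.dom.T0_comp_graph_left[OF left.map_hom[OF Ff] left.map_hom[OF Fg] counit_hom[OF y]]
        right.dom.T0_comp_graph_right[OF counit_hom[OF x] span counit_cartesian[OF span(1)]]
        counit_nat[OF span(2)] ..
  qed (simp_all add: right.dom.T0_comp_add right.T0_map_add left.T0_map_add)
qed

lemma T_adjunction:
  "\<exists>h e. adjunction (T C \<delta>) (T D \<delta>') (T_ftor C D F) (T_ftor D C G) h e"
  unfolding T_def T_ftor_def
  using adjunction.karoubi_adjunction[OF linear_adjunction.add_adjunction[OF T0_linear_adjunction]] by blast

end

theorem corollary5p0p3:
  fixes A :: "('o, 'a) cat" and A' :: "('p, 'b) cat"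
    and \<delta> :: "'a \<Rightarrow> 'k::field" and \<delta>' :: "'b \<Rightarrow> 'k"
    and F :: "('o, 'a, 'p, 'b) ftor" and G :: "('p, 'b, 'o, 'a) ftor"
    and \<eta> :: "'p \<Rightarrow> 'b" and \<epsilon> :: "'o \<Rightarrow> 'a"
    and J :: "('j, 'l) cat"
  assumes "regular_category A" and "regular_category A'"
    and "degree_function A \<delta>" and "degree_function A' \<delta>'"
    and "adjunction A A' F G \<eta> \<epsilon>"
    and "preserves_degree A \<delta> A' \<delta>' F" and "preserves_degree A' \<delta>' A \<delta> G"
    and "preserves_pullbacks A' A G"
    and "\<And>f' x' y'. f' \<in> hom A' x' y' \<Longrightarrow>
      is_pullback A' (\<eta> y') (on_arr F (on_arr G f')) f' (\<eta> x')"
    and "\<And>f x y. f \<in> hom A x y \<Longrightarrow>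
      is_pullback A (\<epsilon> y) f (on_arr G (on_arr F f)) (\<epsilon> x)"
    and "category J"
  shows "cfunctor (T A \<delta>) (T A' \<delta>') (T_ftor A A' F) \<and>
    preserves_limits J (T A \<delta>) (T A' \<delta>') (T_ftor A A' F)"
proof -
  interpret adjunction A A' F G \<eta> \<epsilon> by (rule assms(5))
  have graded: "graded_category A \<delta>" "graded_category A' \<delta>'"
    using assms(1-4) by (auto intro: graded_category.intro)
  \<comment> \<open>The pullback condition for \<open>G\<close> is an assumption, whereas the one
    for \<open>F\<close> comes from the adjunction and the regularity of \<open>A\<close>.\<close>
  have "graded_functor A \<delta> A' \<delta>' F" "graded_functor A' \<delta>' A \<delta> G"
    using graded right.cfunctor_axioms left.cfunctor_axioms assms(6-8) right_preserves_pullbacks[OF assms(1)]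
    by (auto intro!: graded_functor.intro graded_functor_axioms.intro)
  then have "graded_adjunction A \<delta> A' \<delta>' F G \<eta> \<epsilon>"
    using assms(5,9,10) by (intro graded_adjunction.intro graded_adjunction_axioms.intro)
  then obtain h e where adj: "adjunction (T A \<delta>) (T A' \<delta>') (T_ftor A A' F) (T_ftor A' A G) h e"
    using graded_adjunction.T_adjunction by blast
  then show ?thesis
    using adjunction.right_adjoint_preserves_limits[OF adj] adjunction.axioms(1)[OF adj] by blast
qed

end
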